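(* For every integer $M\ge 1$ let $K(M)$ denote the best (smallest) constant such that $$\Big\|\sum_{n=1}^{M}a_n e(nx_1+n^2x_2)\Big\|_{L^6([0,1]^2)}\le K(M)\Big(\sum_{n=1}^{M}|a_n|^2\Big)^{1/2}$$ for all sequences of complex numbers $\{a_n\}_{n=1}^{M}$. Then for every $\varepsilon>0$ there exists a constant $C_\varepsilon>0$ such that for every integer $M\ge 2$, $$K(M)\le C_\varepsilon(\log M)^{2+\varepsilon}.$$
   Context: $e(z):=e^{2\pi i z}$. The $L^6([0,1]^2)$ norm is taken in the variables $(x_1,x_2)$ with respect to Lebesgue measure. *)

theory Defs
  imports "HOL-Analysis.Analysis"
begin

definition e :: "real \<Rightarrow> complex"
  where "e z = exp (2 * of_real pi * \<i> * of_real z)"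

definition quadratic_exp_sum :: "nat \<Rightarrow> (nat \<Rightarrow> complex) \<Rightarrow> real \<times> real \<Rightarrow> complex"
  where "quadratic_exp_sum M a x = (\<Sum>n=1..M. a n * e (real n * fst x + (real n)\<^sup>2 * snd x))"

definition L6_norm :: "(real \<times> real \<Rightarrow> complex) \<Rightarrow> real"
  where "L6_norm f = (LINT x:{0..1} \<times> {0..1}|lborel. (cmod (f x)) ^ 6) powr (1 / 6)"

definition admissible_constants :: "nat \<Rightarrow> real set"
  where "admissible_constants M =
    {C. \<forall>a :: nat \<Rightarrow> complex.
          L6_norm (quadratic_exp_sum M a) \<le> C * sqrt (\<Sum>n=1..M. (cmod (a n))\<^sup>2)}"

text \<open>For \<open>M \<ge> 1\<close> the infimum is attained (lemma \<open>best_constant_least\<close> below), so it is the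
  smallest admissible constant. Nothing is claimed about \<open>M = 0\<close>.\<close>

definition best_constant :: "nat \<Rightarrow> real"
  where "best_constant M = Inf (admissible_constants M)"

lemma L6_norm_nonneg: "0 \<le> L6_norm f"
  by (simp add: L6_norm_def)

lemma norm_e [simp]: "cmod (e z) = 1"
  by (simp add: e_def norm_exp_eq_Re)

lemma quadratic_exp_sum_bound:
  "cmod (quadratic_exp_sum M a x) \<le> sqrt (real M) * sqrt (\<Sum>n=1..M. (cmod (a n))\<^sup>2)"
proof -
  have "cmod (quadratic_exp_sum M a x) \<le> (\<Sum>n=1..M. cmod (a n))"
    unfolding quadratic_exp_sum_def
    by (rule order_trans[OF norm_sum]) (simp add: norm_mult)
  also have "\<dots> \<le> L2_set (\<lambda>n. 1) {1..M} * L2_set (\<lambda>n. cmod (a n)) {1..M}"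
    using L2_set_mult_ineq[of "\<lambda>n. 1" "\<lambda>n. cmod (a n)" "{1..M}"] by simp
  finally show ?thesis by (simp add: L2_set_def)
qed

lemma L6_norm_le:
  assumes "\<And>x. cmod (f x) \<le> B"
  shows "L6_norm f \<le> B"
proof -
  let ?S = "{0..1} \<times> {0..1} :: (real \<times> real) set"
  have S: "?S = cbox (0,0) (1,1)" by (simp add: cbox_Pair_eq)
  have B: "0 \<le> B" using assms[of 0] norm_ge_zero order_trans by blast
  have "measure lborel ?S = 1"
    unfolding S by (subst content_cbox) (auto simp: Basis_prod_def prod.union_disjoint prod.reindex inj_on_def)
  have "(LINT x:?S|lborel. cmod (f x) ^ 6) \<le> (LINT x:?S|lborel. B ^ 6)"
  proof (cases "set_integrable lborel ?S (\<lambda>x. cmod (f x) ^ 6)")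
    case True
    have "set_integrable lborel ?S (\<lambda>x. B ^ 6)"
      unfolding S set_integrable_def
      by (simp add: emeasure_lborel_cbox_eq less_top[symmetric] ennreal_mult_less_top)
    then show ?thesis
      using True assms by (intro set_integral_mono) (auto intro!: power_mono)
  next
    case False
    then have "(LINT x:?S|lborel. cmod (f x) ^ 6) = 0"
      unfolding set_integrable_def set_lebesgue_integral_def by (rule not_integrable_integral_eq)
    then show ?thesis
      unfolding set_lebesgue_integral_def using B by simp
  qed
  also have "\<dots> = B ^ 6"
    unfolding set_lebesgue_integral_def
    using \<open>measure lborel ?S = 1\<close> by (simp add: S)
  finally have "L6_norm f \<le> (B ^ 6) powr (1 / 6)"
    unfolding L6_norm_def
    by (intro powr_mono2) (auto simp: set_lebesgue_integral_def intro!: integral_nonneg_AE)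
  also have "\<dots> = B"
    using B by (cases "B = 0") (auto simp: powr_powr simp flip: powr_numeral)
  finally show ?thesis .
qed

lemma best_constant_least:
  assumes "M \<ge> 1"
  shows "best_constant M \<in> admissible_constants M"
    and "C \<in> admissible_constants M \<Longrightarrow> best_constant M \<le> C"
proof -
  have ne: "sqrt (real M) \<in> admissible_constants M"
    unfolding admissible_constants_def by (blast intro: L6_norm_le quadratic_exp_sum_bound)
  have lb: "0 \<le> C" if "C \<in> admissible_constants M" for C
  proof -
    have "0 \<le> C * sqrt (\<Sum>n=1..M. (cmod 1)\<^sup>2)"
      using that L6_norm_nonneg[of "quadratic_exp_sum M (\<lambda>_. 1)"] order_trans
      unfolding admissible_constants_def by blast
    then show ?thesis using assms by (simp add: zero_le_mult_iff)
  qed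
  then have bdd: "bdd_below (admissible_constants M)" by (meson bdd_belowI)
  show "best_constant M \<le> C" if "C \<in> admissible_constants M"
    unfolding best_constant_def using that bdd by (rule cInf_lower)
  show "best_constant M \<in> admissible_constants M"
    unfolding admissible_constants_def
  proof (clarify)
    fix a :: "nat \<Rightarrow> complex"
    let ?N = "L6_norm (quadratic_exp_sum M a)" and ?l = "sqrt (\<Sum>n=1..M. (cmod (a n))\<^sup>2)"
    have adm: "?N \<le> C * ?l" if "C \<in> admissible_constants M" for C
      using that unfolding admissible_constants_def by blast
    have l: "0 \<le> ?l" by (simp add: sum_nonneg)
    show "?N \<le> best_constant M * ?l"
    proof (cases "?l = 0")
      case True
      then show ?thesis using adm[OF ne] by simp
    next
      case False
      with l have "0 < ?l" by linarith
      then have "?N / ?l \<le> best_constant M"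
        unfolding best_constant_def using ne adm
        by (intro cInf_greatest) (auto simp only: pos_divide_le_eq)
      then show ?thesis using \<open>0 < ?l\<close> by (simp only: pos_divide_le_eq)
    qed
  qed
qed

end

theory Submission
  imports Defs "HOL-Library.Real_Mod"
begin

text \<open>
  The proof is a 3-adic version of the high-low frequency method of Guth, Maldague and Wang, in the
  spirit of Guo, Li and Yung. It gives the exponent 11/6.

  Since 6 is even, the sixth moment of \<open>f(x) = \<Sum>n. a n * e(n x\<^sub>1 + n\<^sup>2 x\<^sub>2)\<close> is the weighted number
  \<open>sixth_energy\<close> of solutions of \<open>n\<^sub>1 + n\<^sub>2 + n\<^sub>3 = n\<^sub>4 + n\<^sub>5 + n\<^sub>6\<close>, and the same for squares. Hence it is
  the same on the torus and on the grid of points \<open>x / 3^L\<close> for every large \<open>L\<close>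
  (\<open>torus_sixth_moment\<close>, \<open>exp_sum_sixth_moment\<close>), and it does not change when the frequencies
  undergo an affine map (\<open>sixth_energy_affine\<close>). On the grid, frequency intervals are replaced
  by residue classes \<open>c\<close> modulo \<open>3^k\<close>. The piece of \<open>f\<close> with frequencies in such a class is exactly
  equivariant under a group of translations (\<open>equivariant\<close>), so that all forms of
  the uncertainty principle hold without error terms, and they follow from translations alone.

  Let \<open>r = \<Sum>n. |a n|\<^sup>2\<close> and let the frequencies lie below \<open>3^J\<close>. On the set where \<open>|f| \<ge> \<alpha>\<close>,
  wave packets larger than \<open>lam \<approx> J\<^sup>2 r / \<alpha>\<close> are removed, scale by scale from the finest one.
  Let \<open>g k\<close> be the square function of the pruned packets at scale \<open>k\<close>. Three facts carry the argument.
  \<^item> The part of \<open>g k\<close> with low frequencies is at most \<open>g (k + 1)\<close>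
    (\<open>smooth_square_function_le\<close>), and the finest \<open>g\<close> is the constant \<open>r\<close>.
  \<^item> The high frequencies of different packets are orthogonal, so the high part of \<open>g k\<close> has mean
    square at most \<open>2 lam\<^sup>2 r\<close> (\<open>grid_sum_high_le\<close>). Here the removal of large packets pays off.
  \<^item> For residues \<open>i \<noteq> j\<close> modulo 3 the product of the corresponding parts of \<open>f\<close> is bounded in mean square by
    \<open>g k\<close>, even locally where \<open>g k\<close> is constant (\<open>bilinear_local_orthogonality\<close>): this
    rests on the fact that \<open>u + v\<close> and \<open>u\<^sup>2 + v\<^sup>2\<close> determine \<open>u\<close> and \<open>v\<close> when \<open>u - v\<close> is a 3-adic unit.

  A point is broad if no single residue class modulo 3 carries nearly all of \<open>f\<close>. At a broad point with
  \<open>\<alpha>\<^sup>2 \<ge> 12 r\<close>, the square functions cannot be low at all scales, for then \<open>|f|\<^sup>2\<close> would be less than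
  \<open>12 r\<close>. At the finest scale where \<open>g k\<close> exceeds \<open>(1 + 1/J) g (k + 1)\<close>, the high part controls \<open>g k\<close>, and
  pruning at the finer scales changed \<open>f\<close> by little since those square functions are still \<open>O(r)\<close>.
  The three facts then bound the size of the level set (\<open>broad_level_set_bound\<close>), and summation over
  dyadic \<open>\<alpha>\<close> bounds the sixth moment over broad points by \<open>O(J^10 r^3)\<close> (\<open>broad_sixth_moment\<close>). At all
  other points \<open>f\<close> is at most \<open>1 + 1/J\<close> times its part in one residue class modulo 3, which is a sum of the
  same kind with \<open>J - 1\<close> in place of \<open>J\<close>. Induction over \<open>J\<close> steps costs a bounded factor and one
  more factor \<open>J\<close> (\<open>energy_bound_log_power\<close>), and \<open>J\<close> is of order \<open>log M\<close>. As \<open>J\<close> decreases in this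
  induction while the losses refer to its initial value, the latter is a separate parameter \<open>A\<close>.
\<close>


section \<open>Characters and Parseval on a finite grid\<close>

definition chi :: "nat \<Rightarrow> int \<Rightarrow> complex"
  where "chi N m = cis (2 * pi * real_of_int m / real N)"

lemma norm_chi [simp]: "cmod (chi N m) = 1"
  by (simp add: chi_def)

lemma chi_add: "chi N (m + n) = chi N m * chi N n"
  by (simp add: chi_def cis_mult add_divide_distrib distrib_left)

lemma cnj_chi: "cnj (chi N m) = chi N (- m)"
  by (simp add: chi_def cis_cnj)

lemma chi_eq_1_iff:
  assumes "N > 0"
  shows "chi N m = 1 \<longleftrightarrow> int N dvd m"
proof
  assume "chi N m = 1"
  then obtain n :: int where n: "2 * pi * real_of_int m / real N = of_int n * (2 * pi)"
    unfolding chi_def cis_eq_1_iff by blast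
  then have "real_of_int m = real_of_int (int N * n)"
    using assms by (simp add: field_simps)
  then show "int N dvd m" by (metis dvd_triv_left of_int_eq_iff)
next
  assume "int N dvd m"
  then obtain n where "m = int N * n" by (elim dvdE)
  then have "2 * pi * real_of_int m / real N = of_int n * (2 * pi)"
    using assms by simp
  then show "chi N m = 1"
    unfolding chi_def cis_eq_1_iff by blast
qed

lemma chi_cong:
  assumes "N > 0" "int N dvd m - n"
  shows "chi N m = chi N n"
  using chi_add[of N "m - n" n] assms by (simp add: chi_eq_1_iff)

lemma chi_mult_left:
  assumes "d > 0"
  shows "chi (d * N) (int d * m) = chi N m"
  using assms by (simp add: chi_def mult.assoc)

lemma sum_chi:
  assumes N: "N > 0"
  shows "(\<Sum>j\<in>{0..<int N}. chi N (m * j)) = (if int N dvd m then of_nat N else 0)"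
proof -
  have pow: "chi N (m * int j) = chi N m ^ j" for j
    by (induction j) (simp_all add: distrib_left chi_add, simp add: chi_def)
  have "(\<Sum>j\<in>{0..<int N}. chi N (m * j)) = (\<Sum>j<N. chi N (m * int j))"
    by (rule sum.reindex_bij_witness[of _ int nat]) auto
  also have "\<dots> = (\<Sum>j<N. chi N m ^ j)"
    by (simp add: pow)
  also have "\<dots> = (if int N dvd m then of_nat N else 0)"
  proof (cases "int N dvd m")
    case True
    then have "chi N m = 1" using N by (simp add: chi_eq_1_iff)
    then show ?thesis using True by simp
  next
    case False
    then have "chi N m \<noteq> 1" using N by (simp add: chi_eq_1_iff)
    moreover have "chi N m ^ N = 1"
      using N by (simp flip: pow add: chi_eq_1_iff)
    ultimately show ?thesis using False by (simp add: geometric_sum)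
  qed
  finally show ?thesis .
qed

text \<open>Functions on the grid of side \<open>N\<close> are represented by functions on all integer points; the
  translation arguments below need them to be periodic with period \<open>N\<close> in each variable.\<close>

definition grid_sum :: "nat \<Rightarrow> (int \<Rightarrow> int \<Rightarrow> 'a) \<Rightarrow> 'a::comm_monoid_add"
  where "grid_sum N h = (\<Sum>x\<in>{0..<int N}. \<Sum>y\<in>{0..<int N}. h x y)"

lemma grid_sum_add: "grid_sum N (\<lambda>x y. f x y + g x y) = grid_sum N f + grid_sum N g"
  by (simp add: grid_sum_def sum.distrib)

lemma grid_sum_sum: "grid_sum N (\<lambda>x y. \<Sum>i\<in>I. f i x y) = (\<Sum>i\<in>I. grid_sum N (f i))"
proof -
  have "grid_sum N (\<lambda>x y. \<Sum>i\<in>I. f i x y) = (\<Sum>x\<in>{0..<int N}. \<Sum>i\<in>I. \<Sum>y\<in>{0..<int N}. f i x y)"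
    unfolding grid_sum_def by (intro sum.cong refl sum.swap)
  also have "\<dots> = (\<Sum>i\<in>I. grid_sum N (f i))"
    unfolding grid_sum_def by (rule sum.swap)
  finally show ?thesis .
qed

lemma grid_sum_cmult:
  fixes c :: "'a::comm_semiring_0"
  shows "grid_sum N (\<lambda>x y. c * f x y) = c * grid_sum N f"
  by (simp add: grid_sum_def sum_distrib_left)

lemma grid_sum_of_real: "of_real (grid_sum N f) = grid_sum N (\<lambda>x y. of_real (f x y))"
  by (simp add: grid_sum_def)

lemma grid_sum_mono:
  fixes f g :: "int \<Rightarrow> int \<Rightarrow> real"
  assumes "\<And>x y. f x y \<le> g x y"
  shows "grid_sum N f \<le> grid_sum N g"
  unfolding grid_sum_def by (intro sum_mono assms)

lemma grid_sum_const: "grid_sum N (\<lambda>x y. c) = (real N)\<^sup>2 * c"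
  by (simp add: grid_sum_def power2_eq_square)

lemma sum_shift_periodic:
  fixes h :: "int \<Rightarrow> 'a::comm_monoid_add"
  assumes "\<And>x m. h (x + int N * m) = h x"
  shows "(\<Sum>x\<in>{0..<int N}. h (x + s)) = (\<Sum>x\<in>{0..<int N}. h x)"
proof (cases "N = 0")
  case False
  have per: "h (x mod int N) = h x" for x
    using assms[of "x mod int N" "x div int N"] by simp
  show ?thesis
    by (rule sum.reindex_bij_witness[of _ "\<lambda>x. (x - s) mod int N" "\<lambda>x. (x + s) mod int N"])
       (use False in \<open>auto simp: per mod_simps\<close>)
qed auto

lemma grid_sum_shift:
  fixes h :: "int \<Rightarrow> int \<Rightarrow> 'a::comm_monoid_add"
  assumes "\<And>x y m n. h (x + int N * m) (y + int N * n) = h x y"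
  shows "grid_sum N (\<lambda>x y. h (x + s) (y + t)) = grid_sum N h"
proof -
  have "(\<Sum>y\<in>{0..<int N}. h x (y + t)) = (\<Sum>y\<in>{0..<int N}. h x y)" for x
    using assms[of x 0] by (intro sum_shift_periodic) simp
  then have "grid_sum N (\<lambda>x y. h (x + s) (y + t)) = (\<Sum>x\<in>{0..<int N}. \<Sum>y\<in>{0..<int N}. h (x + s) y)"
    by (simp add: grid_sum_def)
  also have "\<dots> = grid_sum N h"
    unfolding grid_sum_def using assms[of _ _ _ 0]
    by (intro sum_shift_periodic[where h = "\<lambda>x. \<Sum>y\<in>{0..<int N}. h x y"]) simp
  finally show ?thesis .
qed

lemma grid_sum_chi:
  assumes N: "N > 0"
  shows "grid_sum N (\<lambda>x y. chi N (u * x + v * y)) =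
    (if int N dvd u \<and> int N dvd v then of_nat (N\<^sup>2) else 0)"
  using sum_chi[OF N, of u] sum_chi[OF N, of v]
  by (simp add: grid_sum_def chi_add power2_eq_square flip: sum_distrib_left sum_distrib_right)

lemma norm_power2_sum_chi:
  "of_real ((cmod (\<Sum>i\<in>I. b i * chi N (u i * x + v i * y)))\<^sup>2) =
    (\<Sum>i\<in>I. \<Sum>j\<in>I. b i * cnj (b j) * chi N ((u i - u j) * x + (v i - v j) * y))"
  unfolding complex_norm_square cnj_sum sum_product
proof (intro sum.cong refl)
  fix i j
  have "(u i - u j) * x + (v i - v j) * y = (u i * x + v i * y) + - (u j * x + v j * y)"
    by (simp add: algebra_simps)
  then have "chi N ((u i - u j) * x + (v i - v j) * y) =
      chi N (u i * x + v i * y) * cnj (chi N (u j * x + v j * y))"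
    by (simp only: cnj_chi flip: chi_add)
  then show "b i * chi N (u i * x + v i * y) * cnj (b j * chi N (u j * x + v j * y)) =
      b i * cnj (b j) * chi N ((u i - u j) * x + (v i - v j) * y)"
    by simp
qed

lemma parseval_grid:
  assumes N: "N > 0"
  shows "of_real (grid_sum N (\<lambda>x y. (cmod (\<Sum>i\<in>I. b i * chi N (u i * x + v i * y)))\<^sup>2)) =
    of_nat (N\<^sup>2) * (\<Sum>i\<in>I. \<Sum>j\<in>I. if int N dvd u i - u j \<and> int N dvd v i - v j
        then b i * cnj (b j) else 0)"
  unfolding grid_sum_of_real norm_power2_sum_chi grid_sum_sum grid_sum_cmult grid_sum_chi[OF N]
  by (auto simp: sum_distrib_left intro!: sum.cong)

lemma parseval_grid_orthogonal:
  assumes N: "N > 0" and I: "finite I"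
    and sep: "\<And>i j. i \<in> I \<Longrightarrow> j \<in> I \<Longrightarrow> int N dvd u i - u j \<Longrightarrow> int N dvd v i - v j \<Longrightarrow> i = j"
  shows "grid_sum N (\<lambda>x y. (cmod (\<Sum>i\<in>I. b i * chi N (u i * x + v i * y)))\<^sup>2) =
    (real N)\<^sup>2 * (\<Sum>i\<in>I. (cmod (b i))\<^sup>2)"
proof -
  have "(\<Sum>i\<in>I. \<Sum>j\<in>I. if int N dvd u i - u j \<and> int N dvd v i - v j
        then b i * cnj (b j) else 0) = (\<Sum>i\<in>I. \<Sum>j\<in>I. if i = j then b i * cnj (b j) else 0)"
    using sep by (intro sum.cong refl) auto
  also have "\<dots> = of_real (\<Sum>i\<in>I. (cmod (b i))\<^sup>2)"
    using I by (simp add: complex_norm_square del: of_real_power)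
  finally have "complex_of_real (grid_sum N (\<lambda>x y. (cmod (\<Sum>i\<in>I. b i * chi N (u i * x + v i * y)))\<^sup>2)) =
     of_real ((real N)\<^sup>2 * (\<Sum>i\<in>I. (cmod (b i))\<^sup>2))"
    unfolding parseval_grid[OF N] by simp
  then show ?thesis by (simp only: of_real_eq_iff)
qed

text \<open>The unimodular factor \<open>w j\<close> is common to all three frequencies; in the application it is the phase
  of the residue class that the three frequencies refine.\<close>

lemma parseval_mod_three:
  assumes w: "\<And>t. cmod (w t) = 1"
  shows "(\<Sum>j\<in>{0..<3}. (cmod (\<Sum>t\<in>{0..<3::int}. b t * (w j * chi 3 (t * j))))\<^sup>2) = 3 * (\<Sum>t\<in>{0..<3}. (cmod (b t))\<^sup>2)"
proof -
  have "(cmod (\<Sum>t\<in>{0..<3::int}. b t * (w j * chi 3 (t * j))))\<^sup>2 = (cmod (\<Sum>t\<in>{0..<3::int}. b t * chi 3 (t * j + 0 * y)))\<^sup>2" for j y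
  proof -
    have "(\<Sum>t\<in>{0..<3::int}. b t * (w j * chi 3 (t * j))) = w j * (\<Sum>t\<in>{0..<3::int}. b t * chi 3 (t * j + 0 * y))"
      by (simp add: sum_distrib_left mult_ac)
    then show ?thesis by (simp add: norm_mult w)
  qed
  \<comment> \<open>The second variable of the grid is a dummy and contributes the factor 3.\<close>
  then have "3 * (\<Sum>j\<in>{0..<3}. (cmod (\<Sum>t\<in>{0..<3::int}. b t * (w j * chi 3 (t * j))))\<^sup>2) =
    grid_sum 3 (\<lambda>x y. (cmod (\<Sum>t\<in>{0..<3::int}. b t * chi 3 (t * x + 0 * y)))\<^sup>2)"
    by (simp add: grid_sum_def sum_distrib_left)
  also have "\<dots> = 9 * (\<Sum>t\<in>{0..<3::int}. (cmod (b t))\<^sup>2)"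
  proof (subst parseval_grid_orthogonal)
    show "i = j" if "i \<in> {0..<3}" "j \<in> {0..<3}" "int 3 dvd i - j" for i j :: int
      using that by auto presburger
  qed auto
  finally show ?thesis by simp
qed

section \<open>Equivariance: sharp frequency localization at a 3-adic scale\<close>

text \<open>A function on the grid of side \<open>3^L\<close> all of whose frequencies \<open>(n, m)\<close> satisfy \<open>n \<equiv> c (mod 3^k)\<close> and
  \<open>m \<equiv> n\<^sup>2 (mod 3^(2k))\<close> transforms like the single frequency \<open>(c, c\<^sup>2)\<close> under the translations \<open>(s, t)\<close> that
  are dual to this region of frequencies, because
  \<open>(c + 3^k m) s + (c + 3^k m)\<^sup>2 t = c s + c\<^sup>2 t + m 3^k (s + 2 c t) + m\<^sup>2 3^(2k) t\<close>. This transformation law,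
  unlike the form of an exponential sum, survives multiplication by the indicator of an invariant set.\<close>

definition equivariant :: "nat \<Rightarrow> nat \<Rightarrow> int \<Rightarrow> (int \<Rightarrow> int \<Rightarrow> complex) \<Rightarrow> bool"
  where "equivariant L k c F \<longleftrightarrow>
    (\<forall>x y s t. 3 ^ L dvd 3 ^ k * (s + 2 * c * t) \<longrightarrow> 3 ^ L dvd 3 ^ (2 * k) * t \<longrightarrow>
      F (x + s) (y + t) = chi (3 ^ L) (c * s + c\<^sup>2 * t) * F x y)"

lemma equivariantD:
  assumes "equivariant L k c F" "3 ^ L dvd 3 ^ k * (s + 2 * c * t)" "3 ^ L dvd 3 ^ (2 * k) * t"
  shows "F (x + s) (y + t) = chi (3 ^ L) (c * s + c\<^sup>2 * t) * F x y"
  using assms unfolding equivariant_def by blast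

lemma equivariant_cmod:
  assumes "equivariant L k c F" "3 ^ L dvd 3 ^ k * (s + 2 * c * t)" "3 ^ L dvd 3 ^ (2 * k) * t"
  shows "cmod (F (x + s) (y + t)) = cmod (F x y)"
  using equivariantD[OF assms] by (simp add: norm_mult)

text \<open>The translations by multiples of \<open>3^(L-k)\<close> in both variables belong to the dual groups of all
  residue classes \<open>c\<close> at scale \<open>k\<close>. They see the frequency \<open>(c, c\<^sup>2)\<close> only modulo \<open>3^k\<close>.\<close>

lemma equivariant_box:
  assumes F: "equivariant L k c F" and k: "k \<le> L"
  shows "F (x + 3 ^ (L - k) * s) (y + 3 ^ (L - k) * t) = chi (3 ^ k) (c * s + c\<^sup>2 * t) * F x y"
proof -
  have L: "(3::int) ^ L = 3 ^ k * 3 ^ (L - k)"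
    using k by (simp flip: power_add)
  have "F (x + 3 ^ (L - k) * s) (y + 3 ^ (L - k) * t) =
      chi (3 ^ L) (c * (3 ^ (L - k) * s) + c\<^sup>2 * (3 ^ (L - k) * t)) * F x y"
  proof (rule equivariantD[OF F])
    have "3 ^ k * (3 ^ (L - k) * s + 2 * c * (3 ^ (L - k) * t)) = 3 ^ L * (s + 2 * c * t)"
      unfolding L by (simp add: algebra_simps)
    then show "3 ^ L dvd 3 ^ k * (3 ^ (L - k) * s + 2 * c * (3 ^ (L - k) * t))" by (rule dvdI)
    have "3 ^ (2 * k) * (3 ^ (L - k) * t) = 3 ^ L * (3 ^ k * t)"
      unfolding L mult_2 power_add by simp
    then show "3 ^ L dvd 3 ^ (2 * k) * (3 ^ (L - k) * t)" by (rule dvdI)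
  qed
  also have "c * (3 ^ (L - k) * s) + c\<^sup>2 * (3 ^ (L - k) * t) = int (3 ^ (L - k)) * (c * s + c\<^sup>2 * t)"
    by (simp add: algebra_simps)
  also have "chi (3 ^ L) (int (3 ^ (L - k)) * (c * s + c\<^sup>2 * t)) = chi (3 ^ k) (c * s + c\<^sup>2 * t)"
    using chi_mult_left[of "3 ^ (L - k)" "3 ^ k" "c * s + c\<^sup>2 * t"] k by (simp flip: power_add)
  finally show ?thesis .
qed

lemma equivariant_cmod_box:
  assumes "equivariant L k c F" "l \<le> k" "k \<le> L"
  shows "cmod (F (x + 3 ^ (L - l) * s) (y + 3 ^ (L - l) * t)) = cmod (F x y)"
proof -
  have "(3::int) ^ (L - l) = 3 ^ (L - k) * 3 ^ (k - l)"
    using assms by (simp flip: power_add)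
  then show ?thesis
    using equivariant_box[OF assms(1,3), of x "3 ^ (k - l) * s" y "3 ^ (k - l) * t"]
    by (simp add: norm_mult mult.assoc)
qed

lemma equivariant_periodic:
  assumes "equivariant L k c F"
  shows "F (x + int (3 ^ L) * s) (y + int (3 ^ L) * t) = F x y"
proof -
  have "F (x + 3 ^ L * s) (y + 3 ^ L * t) = chi (3 ^ L) (c * (3 ^ L * s) + c\<^sup>2 * (3 ^ L * t)) * F x y"
    by (rule equivariantD[OF assms]) (simp_all add: dvd_add dvd_mult dvd_mult2)
  also have "chi (3 ^ L) (c * (3 ^ L * s) + c\<^sup>2 * (3 ^ L * t)) = 1"
    by (subst chi_eq_1_iff) (simp_all add: dvd_add dvd_mult dvd_mult2)
  finally show ?thesis by simp
qed

lemma equivariant_character: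
  "equivariant L k c (\<lambda>x y. b * chi (3 ^ L) (c * x + c\<^sup>2 * y))"
  unfolding equivariant_def
proof (intro allI impI)
  fix x y s t :: int
  have "c * (x + s) + c\<^sup>2 * (y + t) = (c * s + c\<^sup>2 * t) + (c * x + c\<^sup>2 * y)"
    by (simp add: algebra_simps)
  then show "b * chi (3 ^ L) (c * (x + s) + c\<^sup>2 * (y + t)) =
      chi (3 ^ L) (c * s + c\<^sup>2 * t) * (b * chi (3 ^ L) (c * x + c\<^sup>2 * y))"
    by (simp only: chi_add[of _ "c * s + c\<^sup>2 * t"] mult.left_commute)
qed

text \<open>The dual group of a residue class is contained in that of each subclass, and on it the two
  characters agree. Sums of packets of a finer scale therefore are functions of the coarser scale.\<close>

lemma equivariant_coarser:
  assumes F: "equivariant L (Suc k) (c + 3 ^ k * u) F"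
  shows "equivariant L k c F"
  unfolding equivariant_def
proof (intro allI impI)
  fix x y s t :: int
  assume 1: "3 ^ L dvd 3 ^ k * (s + 2 * c * t)" and 2: "3 ^ L dvd 3 ^ (2 * k) * t"
  have "F (x + s) (y + t) = chi (3 ^ L) ((c + 3 ^ k * u) * s + (c + 3 ^ k * u)\<^sup>2 * t) * F x y"
  proof (rule equivariantD[OF F])
    have "3 ^ Suc k * (s + 2 * (c + 3 ^ k * u) * t) =
        3 * (3 ^ k * (s + 2 * c * t)) + 6 * u * (3 ^ (2 * k) * t)"
      unfolding mult_2 power_add by (simp add: algebra_simps)
    then show "3 ^ L dvd 3 ^ Suc k * (s + 2 * (c + 3 ^ k * u) * t)"
      using 1 2 by (simp only: dvd_add dvd_mult)
    show "3 ^ L dvd 3 ^ (2 * Suc k) * t"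
      using dvd_mult[OF 2, of 9] by (simp add: mult.assoc)
  qed
  also have "chi (3 ^ L) ((c + 3 ^ k * u) * s + (c + 3 ^ k * u)\<^sup>2 * t) = chi (3 ^ L) (c * s + c\<^sup>2 * t)"
  proof (rule chi_cong)
    have "(c + 3 ^ k * u) * s + (c + 3 ^ k * u)\<^sup>2 * t - (c * s + c\<^sup>2 * t) =
        u * (3 ^ k * (s + 2 * c * t)) + u\<^sup>2 * (3 ^ (2 * k) * t)"
      unfolding mult_2 power_add by (simp add: algebra_simps power2_eq_square)
    then show "int (3 ^ L) dvd (c + 3 ^ k * u) * s + (c + 3 ^ k * u)\<^sup>2 * t - (c * s + c\<^sup>2 * t)"
      using 1 2 by (simp only: of_nat_power of_nat_numeral dvd_add dvd_mult)
  qed simp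
  finally show "F (x + s) (y + t) = chi (3 ^ L) (c * s + c\<^sup>2 * t) * F x y" .
qed

lemma equivariant_sum:
  assumes "\<And>i. i \<in> I \<Longrightarrow> equivariant L k c (F i)"
  shows "equivariant L k c (\<lambda>x y. \<Sum>i\<in>I. F i x y)"
  unfolding equivariant_def
proof (intro allI impI)
  fix x y s t :: int
  assume "3 ^ L dvd 3 ^ k * (s + 2 * c * t)" "3 ^ L dvd 3 ^ (2 * k) * t"
  from equivariantD[OF assms this]
  show "(\<Sum>i\<in>I. F i (x + s) (y + t)) = chi (3 ^ L) (c * s + c\<^sup>2 * t) * (\<Sum>i\<in>I. F i x y)"
    by (simp only: sum_distrib_left cong: sum.cong)
qed

lemma equivariant_truncate:
  assumes "equivariant L k c G"
  shows "equivariant L k c (\<lambda>x y. if cmod (G x y) \<le> lam then G x y else 0)"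
  unfolding equivariant_def
proof (intro allI impI)
  fix x y s t :: int
  assume st: "3 ^ L dvd 3 ^ k * (s + 2 * c * t)" "3 ^ L dvd 3 ^ (2 * k) * t"
  show "(if cmod (G (x + s) (y + t)) \<le> lam then G (x + s) (y + t) else 0) =
      chi (3 ^ L) (c * s + c\<^sup>2 * t) * (if cmod (G x y) \<le> lam then G x y else 0)"
    unfolding equivariantD[OF assms st] by (simp add: norm_mult)
qed

text \<open>On functions with period \<open>3^(L-k)\<close> in the first variable this average is the projection to the
  frequencies with first coordinate divisible by \<open>3^(k+1)\<close>, the low frequencies at scale \<open>k\<close>.\<close>

definition smooth :: "nat \<Rightarrow> nat \<Rightarrow> (int \<Rightarrow> int \<Rightarrow> real) \<Rightarrow> int \<Rightarrow> int \<Rightarrow> real"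
  where "smooth L k h x y = 1 / 3 * (\<Sum>j\<in>{0..<3}. h (x + 3 ^ (L - Suc k) * j) y)"

definition dual_invariant :: "nat \<Rightarrow> nat \<Rightarrow> int \<Rightarrow> (int \<Rightarrow> int \<Rightarrow> real) \<Rightarrow> bool"
  where "dual_invariant L k c h \<longleftrightarrow>
    (\<forall>x y s t. 3 ^ L dvd 3 ^ k * (s + 2 * c * t) \<longrightarrow> 3 ^ L dvd 3 ^ (2 * k) * t \<longrightarrow>
      h (x + s) (y + t) = h x y)"

lemma dual_invariantD:
  assumes "dual_invariant L k c h" "3 ^ L dvd 3 ^ k * (s + 2 * c * t)" "3 ^ L dvd 3 ^ (2 * k) * t"
  shows "h (x + s) (y + t) = h x y"
  using assms unfolding dual_invariant_def by blast

lemma dual_invariant_periodic: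
  assumes "dual_invariant L k c h"
  shows "h (x + int (3 ^ L) * s) (y + int (3 ^ L) * t) = h x y"
  using dual_invariantD[OF assms, of "3 ^ L * s" "3 ^ L * t" x y]
  by (simp add: dvd_add dvd_mult dvd_mult2)

lemma dual_invariant_cmod:
  "equivariant L k c F \<Longrightarrow> dual_invariant L k c (\<lambda>x y. (cmod (F x y))\<^sup>2)"
  unfolding dual_invariant_def by (simp add: equivariant_cmod)

lemma dual_invariant_smooth:
  assumes "dual_invariant L k c h"
  shows "dual_invariant L k c (smooth L k h)"
  unfolding dual_invariant_def
proof (intro allI impI)
  fix x y s t :: int
  assume "3 ^ L dvd 3 ^ k * (s + 2 * c * t)" "3 ^ L dvd 3 ^ (2 * k) * t"
  from dual_invariantD[OF assms this]
  have "h (x + s + 3 ^ (L - Suc k) * j) (y + t) = h (x + 3 ^ (L - Suc k) * j) y" for j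
    by (metis add.assoc add.commute)
  then show "smooth L k h (x + s) (y + t) = smooth L k h x y"
    by (simp only: smooth_def)
qed

lemma grid_sum_smooth:
  assumes "\<And>x y m n. h (x + int (3 ^ L) * m) (y + int (3 ^ L) * n) = h x y"
  shows "grid_sum (3 ^ L) (smooth L k h) = grid_sum (3 ^ L) h"
proof -
  have "grid_sum (3 ^ L) (smooth L k h) =
     1 / 3 * (\<Sum>j\<in>{0..<3::int}. grid_sum (3 ^ L) (\<lambda>x y. h (x + 3 ^ (L - Suc k) * j) (y + 0)))"
    unfolding smooth_def by (simp only: grid_sum_cmult grid_sum_sum add_0_right)
  also have "\<dots> = grid_sum (3 ^ L) h"
    by (simp only: grid_sum_shift[of h "3 ^ L", OF assms]) simp
  finally show ?thesis .
qed

text \<open>Write \<open>d = 3^v m\<close> with \<open>m\<close> prime to 3; then \<open>v < k\<close> and \<open>m\<close> is invertible modulo 3.\<close>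

lemma exists_three_adic_multiple:
  fixes d :: int
  assumes d: "\<not> 3 ^ k dvd d"
  shows "\<exists>z w. d * z = 3 ^ (k - 1) * (1 + 3 * w)"
proof -
  have "d \<noteq> 0" using d by auto
  then obtain m where "d = 3 ^ multiplicity 3 d * m" "\<not> 3 dvd m"
    using multiplicity_decompose'[of d 3] by auto
  then obtain v where vm: "d = 3 ^ v * m" "\<not> 3 dvd m" by blast
  then have v: "v \<le> k - 1"
  proof -
    have "\<not> k \<le> v"
      using d vm(1) le_imp_power_dvd[of k v "3::int"] by (meson dvd_mult2)
    then show ?thesis by simp
  qed
  have "m mod 3 = 1 \<or> m mod 3 = 2" using vm(2) by presburger
  then have "\<exists>n w. m * n = 1 + 3 * w"
  proof
    assume "m mod 3 = 1"
    then have "m * 1 = 1 + 3 * (m div 3)" by presburger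
    then show ?thesis by blast
  next
    assume "m mod 3 = 2"
    then have "m * 2 = 1 + 3 * (2 * (m div 3) + 1)" by presburger
    then show ?thesis by blast
  qed
  then obtain n w where nw: "m * n = 1 + 3 * w" by blast
  have "d * (3 ^ (k - 1 - v) * n) = (3 ^ v * 3 ^ (k - 1 - v)) * (m * n)"
    by (simp add: vm(1))
  also have "\<dots> = 3 ^ (k - 1) * (1 + 3 * w)"
    unfolding nw power_add[symmetric] le_add_diff_inverse[OF v] ..
  finally show ?thesis by blast
qed

text \<open>The dual groups of two residue classes point in the directions \<open>(-2c, 1)\<close> and \<open>(-2c', 1)\<close>. These differ by
  \<open>2(c - c')\<close> in the first coordinate, and as \<open>c - c'\<close> is not divisible by \<open>3^k\<close>, together the two groups
  contain every translation over which \<open>smooth\<close> averages.\<close>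

lemma shift_as_sum_of_dual_shifts:
  assumes k: "2 * k \<le> L" and c: "\<not> 3 ^ k dvd c - c'"
  shows "\<exists>s t s' t'. s + s' = 3 ^ (L - Suc k) * j \<and> t + t' = (0::int) \<and>
    (3 ^ L dvd 3 ^ k * (s + 2 * c * t) \<and> 3 ^ L dvd 3 ^ (2 * k) * t) \<and>
    (3 ^ L dvd 3 ^ k * (s' + 2 * c' * t') \<and> 3 ^ L dvd 3 ^ (2 * k) * t')"
proof -
  have "k > 0" using c by (cases k) auto
  obtain z w where zw: "(c - c') * z = 3 ^ (k - 1) * (1 + 3 * w)"
    using exists_three_adic_multiple[OF c] by blast
  define t where "t = 3 ^ (L - 2 * k) * (z * j)"
  have L: "(3::int) ^ L = 3 ^ (2 * k) * 3 ^ (L - 2 * k)"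
    using k by (simp flip: power_add)
  have L': "(3::int) ^ (L - Suc k) = 3 ^ (k - 1) * 3 ^ (L - 2 * k)"
    using k \<open>k > 0\<close> by (simp flip: power_add)
  have L'': "(3::int) ^ L = 3 ^ k * (3 * (3 ^ (k - 1) * 3 ^ (L - 2 * k)))"
    using k \<open>k > 0\<close> by (simp flip: power_add power_Suc)
  have t: "3 ^ L dvd 3 ^ (2 * k) * t"
    unfolding L t_def by simp
  \<comment> \<open>With this \<open>t\<close>, \<open>2 (c - c') t\<close> is \<open>2 * 3^(L-k-1) j\<close> up to a multiple of \<open>3^(L-k)\<close>, so adding \<open>3^(L-k-1) j\<close> gives a multiple of \<open>3^(L-k)\<close>.\<close>
  have "(c - c') * t = 3 ^ (L - 2 * k) * j * ((c - c') * z)"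
    by (simp add: t_def)
  also have "\<dots> = 3 ^ (L - Suc k) * j * (1 + 3 * w)"
    unfolding zw L' by simp
  finally have "3 ^ (L - Suc k) * j + 2 * c' * - t + 2 * c * t = 3 ^ (L - Suc k) * j * (3 * (1 + 2 * w))"
    by (simp add: algebra_simps)
  then have "3 ^ k * (3 ^ (L - Suc k) * j + 2 * c' * - t + 2 * c * t) = 3 ^ L * (j * (1 + 2 * w))"
    unfolding L'' L' by simp
  then have *: "3 ^ L dvd 3 ^ k * (3 ^ (L - Suc k) * j + 2 * c' * - t + 2 * c * t)"
    by (rule dvdI)
  show ?thesis
    by (rule exI[of _ "3 ^ (L - Suc k) * j + 2 * c' * - t"], rule exI[of _ t],
        rule exI[of _ "2 * c' * t"], rule exI[of _ "- t"])
       (use t * in simp)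
qed

section \<open>Orthogonality of high frequencies and of transversal pairs\<close>

lemma three_power_dvd_diff:
  fixes i j :: int
  assumes "i \<in> {0..<3 ^ k}" "j \<in> {0..<3 ^ k}" "k \<le> L" "3 ^ L dvd i - j"
  shows "i = j"
proof -
  have "3 ^ k dvd i - j" using assms(3,4) le_imp_power_dvd dvd_trans by blast
  then have "i mod 3 ^ k = j mod 3 ^ k" by (simp add: mod_eq_dvd_iff)
  then show ?thesis using assms(1,2) by simp
qed

lemma dual_invariant_diff:
  assumes "dual_invariant L k c h" "dual_invariant L k c g"
  shows "dual_invariant L k c (\<lambda>x y. h x y - g x y)"
  unfolding dual_invariant_def
  using dual_invariantD[OF assms(1)] dual_invariantD[OF assms(2)] by metis

text \<open>Each translation of \<open>smooth\<close> is a sum of one that fixes \<open>h\<close> and one that fixes \<open>h'\<close>, so that it does not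
  change the inner product of \<open>h\<close> and \<open>h'\<close>.\<close>

lemma grid_sum_mult_smooth:
  assumes k: "2 * k \<le> L" and c: "\<not> 3 ^ k dvd c - c'"
    and h: "dual_invariant L k c h" and h': "dual_invariant L k c' h'"
  shows "grid_sum (3 ^ L) (\<lambda>x y. h x y * smooth L k h' x y) = grid_sum (3 ^ L) (\<lambda>x y. h x y * h' x y)"
proof -
  have shift: "grid_sum (3 ^ L) (\<lambda>x y. h x y * h' (x + 3 ^ (L - Suc k) * j) y) =
      grid_sum (3 ^ L) (\<lambda>x y. h x y * h' x y)" for j
  proof -
    obtain s t s' t' where st: "s + s' = 3 ^ (L - Suc k) * j" "t + t' = 0"
      "3 ^ L dvd 3 ^ k * (s + 2 * c * t)" "3 ^ L dvd 3 ^ (2 * k) * t"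
      "3 ^ L dvd 3 ^ k * (s' + 2 * c' * t')" "3 ^ L dvd 3 ^ (2 * k) * t'"
      using shift_as_sum_of_dual_shifts[OF k c, of j] by blast
    have "h x y * h' (x + 3 ^ (L - Suc k) * j) y = h (x + s) (y + t) * h' (x + s) (y + t)" for x y
    proof -
      have "h' (x + 3 ^ (L - Suc k) * j) y = h' ((x + s) + s') ((y + t) + t')"
        using st(1,2) by (simp add: add.assoc)
      also have "\<dots> = h' (x + s) (y + t)"
        by (rule dual_invariantD[OF h' st(5,6)])
      finally show ?thesis by (simp add: dual_invariantD[OF h st(3,4)])
    qed
    then show ?thesis
      using grid_sum_shift[of "\<lambda>x y. h x y * h' x y" "3 ^ L" s t]
        dual_invariant_periodic[OF h] dual_invariant_periodic[OF h'] by simp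
  qed
  have "h x y * smooth L k h' x y = 1 / 3 * (\<Sum>j\<in>{0..<3}. h x y * h' (x + 3 ^ (L - Suc k) * j) y)" for x y
    by (simp only: smooth_def sum_distrib_left mult.left_commute)
  then show ?thesis
    by (simp only: grid_sum_cmult grid_sum_sum shift) simp
qed

lemma smooth_sum: "smooth L k (\<lambda>x y. \<Sum>c\<in>I. h c x y) x y = (\<Sum>c\<in>I. smooth L k (h c) x y)"
  unfolding smooth_def by (subst sum.swap) (simp add: sum_distrib_left)

lemma high_parts_orthogonal:
  assumes k: "2 * k \<le> L" and c: "\<not> 3 ^ k dvd c - c'"
    and h: "dual_invariant L k c h" and h': "dual_invariant L k c' h'"
  shows "grid_sum (3 ^ L) (\<lambda>x y. (h x y - smooth L k h x y) * (h' x y - smooth L k h' x y)) = 0"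
proof -
  let ?h = "\<lambda>x y. h x y - smooth L k h x y"
  have inv: "dual_invariant L k c ?h"
    by (intro dual_invariant_diff dual_invariant_smooth h)
  have "grid_sum (3 ^ L) (\<lambda>x y. ?h x y * (h' x y - smooth L k h' x y)) +
      grid_sum (3 ^ L) (\<lambda>x y. ?h x y * smooth L k h' x y) = grid_sum (3 ^ L) (\<lambda>x y. ?h x y * h' x y)"
    unfolding grid_sum_add[symmetric] by (simp add: algebra_simps)
  then show ?thesis
    using grid_sum_mult_smooth[OF k c inv h'] by simp
qed

text \<open>For nonnegative \<open>h\<close> the mixed term of the square is at most 0, and the square of an average is at most
  the average of the squares.\<close>

lemma grid_sum_high_part_le:
  assumes pos: "\<And>x y. 0 \<le> h x y"
    and per: "\<And>x y m n. h (x + int (3 ^ L) * m) (y + int (3 ^ L) * n) = h x y"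
  shows "grid_sum (3 ^ L) (\<lambda>x y. (h x y - smooth L k h x y)\<^sup>2) \<le>
    2 * grid_sum (3 ^ L) (\<lambda>x y. (h x y)\<^sup>2)"
proof -
  let ?q = "\<lambda>x y. (h x y)\<^sup>2"
  have "(h x y - smooth L k h x y)\<^sup>2 \<le> (h x y)\<^sup>2 + smooth L k ?q x y" for x y
  proof -
    have nn: "0 \<le> smooth L k h x y"
      unfolding smooth_def by (intro mult_nonneg_nonneg sum_nonneg pos) simp
    have "(h x y - smooth L k h x y)\<^sup>2 = (h x y)\<^sup>2 + (smooth L k h x y)\<^sup>2 - 2 * (h x y * smooth L k h x y)"
      by (simp add: power2_diff)
    also have "\<dots> \<le> (h x y)\<^sup>2 + (smooth L k h x y)\<^sup>2"
      using mult_nonneg_nonneg[OF pos[of x y] nn] by linarith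
    also have "(smooth L k h x y)\<^sup>2 \<le> smooth L k ?q x y"
    proof -
      have "(\<Sum>j\<in>{0..<3::int}. h (x + 3 ^ (L - Suc k) * j) y)\<^sup>2 \<le> 3 * (\<Sum>j\<in>{0..<3}. ?q (x + 3 ^ (L - Suc k) * j) y)"
        using sum_squared_le_sum_of_squares[of "\<lambda>j. h (x + 3 ^ (L - Suc k) * j) y" "{0..<3::int}"] by simp
      then show ?thesis
        unfolding smooth_def power_mult_distrib by (simp add: power2_eq_square)
    qed
    finally show ?thesis by simp
  qed
  then have "grid_sum (3 ^ L) (\<lambda>x y. (h x y - smooth L k h x y)\<^sup>2) \<le>
      grid_sum (3 ^ L) (\<lambda>x y. ?q x y + smooth L k ?q x y)"
    by (rule grid_sum_mono)
  also have "\<dots> = 2 * grid_sum (3 ^ L) ?q"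
    unfolding grid_sum_add
    using grid_sum_smooth[of ?q L k] per by simp
  finally show ?thesis .
qed

lemma grid_sum_high_square_function_le:
  assumes k: "2 * k \<le> L"
    and pos: "\<And>c x y. 0 \<le> h c x y"
    and inv: "\<And>c. c \<in> {0..<3 ^ k} \<Longrightarrow> dual_invariant L k c (h c)"
  defines "g \<equiv> \<lambda>x y. \<Sum>c\<in>{0..<3 ^ k}. h c x y"
  shows "grid_sum (3 ^ L) (\<lambda>x y. (g x y - smooth L k g x y)\<^sup>2) \<le>
    2 * grid_sum (3 ^ L) (\<lambda>x y. \<Sum>c\<in>{0..<3 ^ k}. (h c x y)\<^sup>2)"
proof -
  let ?I = "{0..<3 ^ k :: int}"
  let ?h = "\<lambda>c x y. h c x y - smooth L k (h c) x y"
  have "(g x y - smooth L k g x y)\<^sup>2 = (\<Sum>c\<in>?I. \<Sum>c'\<in>?I. ?h c x y * ?h c' x y)" for x y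
    unfolding g_def smooth_sum sum_subtractf[symmetric] power2_eq_square sum_product ..
  then have "grid_sum (3 ^ L) (\<lambda>x y. (g x y - smooth L k g x y)\<^sup>2) =
      (\<Sum>c\<in>?I. \<Sum>c'\<in>?I. grid_sum (3 ^ L) (\<lambda>x y. ?h c x y * ?h c' x y))"
    by (simp only: grid_sum_sum)
  also have "\<dots> = (\<Sum>c\<in>?I. \<Sum>c'\<in>?I. if c = c' then grid_sum (3 ^ L) (\<lambda>x y. (?h c x y)\<^sup>2) else 0)"
  proof (intro sum.cong refl)
    fix c c' assume cc: "c \<in> ?I" "c' \<in> ?I"
    show "grid_sum (3 ^ L) (\<lambda>x y. ?h c x y * ?h c' x y) =
        (if c = c' then grid_sum (3 ^ L) (\<lambda>x y. (?h c x y)\<^sup>2) else 0)"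
    proof (cases "c = c'")
      case True
      then show ?thesis by (simp add: power2_eq_square)
    next
      case False
      have "\<not> 3 ^ k dvd c - c'"
        using three_power_dvd_diff[OF cc order_refl] False by blast
      from high_parts_orthogonal[OF k this inv[OF cc(1)] inv[OF cc(2)]] False
      show ?thesis by simp
    qed
  qed
  also have "\<dots> = (\<Sum>c\<in>?I. grid_sum (3 ^ L) (\<lambda>x y. (?h c x y)\<^sup>2))"
    by simp
  also have "\<dots> \<le> (\<Sum>c\<in>?I. 2 * grid_sum (3 ^ L) (\<lambda>x y. (h c x y)\<^sup>2))"
    by (intro sum_mono grid_sum_high_part_le pos dual_invariant_periodic[OF inv])
  also have "\<dots> = 2 * grid_sum (3 ^ L) (\<lambda>x y. \<Sum>c\<in>?I. (h c x y)\<^sup>2)"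
    by (simp only: grid_sum_sum sum_distrib_left)
  finally show ?thesis .
qed

text \<open>If \<open>a + b\<close> and \<open>a' + b'\<close> agree, as well as the sums of squares, then \<open>(a - a')(a + a' - b - b')\<close> vanishes
  (all modulo \<open>3^k\<close>). The second factor is congruent to \<open>2(i - j)\<close> modulo 3, hence a unit modulo \<open>3^k\<close>.\<close>

lemma transversal_pairs_determined:
  fixes a b a' b' :: int
  assumes "a mod 3 = i" "a' mod 3 = i" "b mod 3 = j" "b' mod 3 = j" "i \<noteq> j"
    and sum: "3 ^ k dvd (a + b) - (a' + b')" and sq: "3 ^ k dvd (a\<^sup>2 + b\<^sup>2) - (a'\<^sup>2 + b'\<^sup>2)"
  shows "3 ^ k dvd a - a' \<and> 3 ^ k dvd b - b'"
proof -
  have "(a - a') * (a + a' - b - b') =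
      ((a\<^sup>2 + b\<^sup>2) - (a'\<^sup>2 + b'\<^sup>2)) - ((a + b) - (a' + b')) * (b + b')"
    by (simp add: algebra_simps power2_eq_square)
  then have "3 ^ k dvd (a - a') * (a + a' - b - b')"
    using sum sq by (simp only: dvd_diff dvd_mult2)
  moreover have "\<not> 3 dvd a + a' - b - b'"
    using assms(1-5) by presburger
  then have "coprime (3 ^ k) (a + a' - b - b')"
    by (intro coprime_power_left_iff[THEN iffD2] disjI1 prime_imp_coprime) auto
  ultimately have 1: "3 ^ k dvd a - a'"
    by (simp add: coprime_dvd_mult_left_iff)
  have "b - b' = ((a + b) - (a' + b')) - (a - a')" by simp
  then show ?thesis using 1 sum by (simp only: dvd_diff)
qed

lemma grid_sum_average_over_boxes:
  fixes h :: "int \<Rightarrow> int \<Rightarrow> real"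
  assumes per: "\<And>x y m n. h (x + int N * m) (y + int N * n) = h x y"
  shows "(real n)\<^sup>2 * grid_sum N h =
    grid_sum N (\<lambda>x y. grid_sum n (\<lambda>s t. h (x + d * s) (y + d * t)))"
proof -
  have "grid_sum N (\<lambda>x y. grid_sum n (\<lambda>s t. h (x + d * s) (y + d * t))) =
    (\<Sum>s\<in>{0..<int n}. \<Sum>t\<in>{0..<int n}. grid_sum N (\<lambda>x y. h (x + d * s) (y + d * t)))"
    unfolding grid_sum_def[of n] by (simp only: grid_sum_sum)
  also have "\<dots> = (real n)\<^sup>2 * grid_sum N h"
    by (simp only: grid_sum_shift[of h, OF per]) (simp add: power2_eq_square)
  finally show ?thesis by simp
qed

text \<open>On a coset of the translations by multiples of \<open>3^(L-k)\<close> the products of packets from two residue classes modulo 3 have pairwise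
  different frequencies modulo \<open>3^k\<close>, so they are orthogonal there, and the packets have constant modulus. The weight
  \<open>w\<close>, constant on these cosets, localizes the identity to unions of them.\<close>

lemma bilinear_local_orthogonality:
  fixes F :: "int \<Rightarrow> int \<Rightarrow> int \<Rightarrow> complex" and w :: "int \<Rightarrow> int \<Rightarrow> real"
  assumes k: "k \<le> L" and "i \<noteq> j"
    and F: "\<And>c. c \<in> {0..<3 ^ k} \<Longrightarrow> equivariant L k c (F c)"
    and w: "\<And>x y s t. w (x + 3 ^ (L - k) * s) (y + 3 ^ (L - k) * t) = w x y"
  defines "A \<equiv> \<lambda>i. {c \<in> {0..<3 ^ k}. c mod 3 = i}"
  shows "grid_sum (3 ^ L) (\<lambda>x y. w x y * (cmod ((\<Sum>c\<in>A i. F c x y) * (\<Sum>c\<in>A j. F c x y)))\<^sup>2) =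
    grid_sum (3 ^ L) (\<lambda>x y. w x y * ((\<Sum>c\<in>A i. (cmod (F c x y))\<^sup>2) * (\<Sum>c\<in>A j. (cmod (F c x y))\<^sup>2)))"
proof -
  let ?I = "A i \<times> A j"
  let ?H = "\<lambda>x y. w x y * (cmod ((\<Sum>c\<in>A i. F c x y) * (\<Sum>c\<in>A j. F c x y)))\<^sup>2"
  have fin: "finite (A i)" for i unfolding A_def by (rule finite_subset[of _ "{0..<3 ^ k}"]) auto
  have L: "(3::int) ^ L = 3 ^ (L - k) * 3 ^ k"
    using k by (simp flip: power_add)
  have on_box: "?H (x + 3 ^ (L - k) * s) (y + 3 ^ (L - k) * t) = w x y *
     (cmod (\<Sum>p\<in>?I. F (fst p) x y * F (snd p) x y *
        chi (3 ^ k) ((fst p + snd p) * s + ((fst p)\<^sup>2 + (snd p)\<^sup>2) * t)))\<^sup>2" for x y s t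
  proof -
    have "chi (3 ^ k) (a * s + a\<^sup>2 * t) * F a x y * (chi (3 ^ k) (b * s + b\<^sup>2 * t) * F b x y) =
      F a x y * F b x y * chi (3 ^ k) ((a + b) * s + (a\<^sup>2 + b\<^sup>2) * t)" for a b
    proof -
      have "(a + b) * s + (a\<^sup>2 + b\<^sup>2) * t = (a * s + a\<^sup>2 * t) + (b * s + b\<^sup>2 * t)"
        by (simp add: algebra_simps)
      then show ?thesis by (simp add: chi_add)
    qed
    moreover have "(\<Sum>c\<in>A i. F c (x + 3 ^ (L - k) * s) (y + 3 ^ (L - k) * t)) =
        (\<Sum>c\<in>A i. chi (3 ^ k) (c * s + c\<^sup>2 * t) * F c x y)" for i
      by (intro sum.cong refl equivariant_box[OF F k]) (simp add: A_def)
    ultimately show ?thesis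
      by (simp only: w sum_product sum.cartesian_product' fst_conv snd_conv)
  qed
  have box: "grid_sum (3 ^ k) (\<lambda>s t. ?H (x + 3 ^ (L - k) * s) (y + 3 ^ (L - k) * t)) =
     (real (3 ^ k))\<^sup>2 * (w x y * ((\<Sum>c\<in>A i. (cmod (F c x y))\<^sup>2) * (\<Sum>c\<in>A j. (cmod (F c x y))\<^sup>2)))" for x y
  proof -
    have "grid_sum (3 ^ k) (\<lambda>s t. ?H (x + 3 ^ (L - k) * s) (y + 3 ^ (L - k) * t)) =
      w x y * ((real (3 ^ k))\<^sup>2 * (\<Sum>p\<in>?I. (cmod (F (fst p) x y * F (snd p) x y))\<^sup>2))"
      unfolding on_box grid_sum_cmult
    proof (subst parseval_grid_orthogonal)
      fix p q assume pq: "p \<in> ?I" "q \<in> ?I"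
        and 1: "int (3 ^ k) dvd (fst p + snd p) - (fst q + snd q)"
        and 2: "int (3 ^ k) dvd ((fst p)\<^sup>2 + (snd p)\<^sup>2) - ((fst q)\<^sup>2 + (snd q)\<^sup>2)"
      have "3 ^ k dvd fst p - fst q \<and> 3 ^ k dvd snd p - snd q"
        by (rule transversal_pairs_determined[of _ i _ _ j]) (use pq 1 2 assms(2) in \<open>auto simp: A_def\<close>)
      moreover have "a = b" if "a \<in> A i" "b \<in> A i" "3 ^ k dvd a - b" for a b i
        by (rule three_power_dvd_diff[OF _ _ order_refl]) (use that in \<open>simp_all add: A_def\<close>)
      ultimately show "p = q" using pq by (metis mem_Times_iff prod_eqI)
    qed (simp_all add: fin)
    also have "(\<Sum>p\<in>?I. (cmod (F (fst p) x y * F (snd p) x y))\<^sup>2) =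
       (\<Sum>c\<in>A i. (cmod (F c x y))\<^sup>2) * (\<Sum>c\<in>A j. (cmod (F c x y))\<^sup>2)"
      by (simp add: sum_product sum.cartesian_product' norm_mult power_mult_distrib)
    finally show ?thesis by (simp only: mult.left_commute)
  qed
  have per: "?H (x + int (3 ^ L) * m) (y + int (3 ^ L) * n) = ?H x y" for x y m n
  proof -
    have "w (x + int (3 ^ L) * m) (y + int (3 ^ L) * n) = w x y"
      using w[of x "3 ^ k * m" y "3 ^ k * n"] by (simp add: L mult.assoc)
    moreover have "(\<Sum>c\<in>A i. F c (x + int (3 ^ L) * m) (y + int (3 ^ L) * n)) = (\<Sum>c\<in>A i. F c x y)" for i
      by (intro sum.cong refl equivariant_periodic[OF F]) (simp add: A_def)
    ultimately show ?thesis by (simp only:)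
  qed
  have "(real (3 ^ k))\<^sup>2 * grid_sum (3 ^ L) ?H = (real (3 ^ k))\<^sup>2 *
     grid_sum (3 ^ L) (\<lambda>x y. w x y * ((\<Sum>c\<in>A i. (cmod (F c x y))\<^sup>2) * (\<Sum>c\<in>A j. (cmod (F c x y))\<^sup>2)))"
    unfolding grid_sum_average_over_boxes[of ?H, OF per, of "3 ^ k" "3 ^ (L - k)"] box grid_sum_cmult ..
  then show ?thesis by simp
qed

section \<open>Pruned wave packets and their square functions\<close>

lemma sum_base_three_split:
  fixes \<phi> :: "int \<Rightarrow> 'a::comm_monoid_add"
  shows "(\<Sum>c\<in>{0..<3 ^ Suc k}. \<phi> c) = (\<Sum>c\<in>{0..<3 ^ k}. \<Sum>t\<in>{0..<3}. \<phi> (c + 3 ^ k * t))"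
  unfolding sum.cartesian_product
proof (rule sum.reindex_bij_witness[of _ "\<lambda>(c, t). c + 3 ^ k * t" "\<lambda>c. (c mod 3 ^ k, c div 3 ^ k)"])
  fix c :: int assume c: "c \<in> {0..<3 ^ Suc k}"
  show "(case (c mod 3 ^ k, c div 3 ^ k) of (c, t) \<Rightarrow> c + 3 ^ k * t) = c" by simp
  have "3 ^ k * (c div 3 ^ k) + c mod 3 ^ k = c" "0 \<le> c mod 3 ^ k" by simp_all
  moreover have "c < 3 ^ k * 3" using c by simp
  ultimately have "3 ^ k * (c div 3 ^ k) < 3 ^ k * 3" by linarith
  then have "c div 3 ^ k < 3" by simp
  then show "(c mod 3 ^ k, c div 3 ^ k) \<in> {0..<3 ^ k} \<times> {0..<3}"
    using c by (simp add: pos_imp_zdiv_nonneg_iff)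
next
  fix p :: "int \<times> int" assume p: "p \<in> {0..<3 ^ k} \<times> {0..<3}"
  then show "((case p of (c, t) \<Rightarrow> c + 3 ^ k * t) mod 3 ^ k, (case p of (c, t) \<Rightarrow> c + 3 ^ k * t) div 3 ^ k) = p"
    by (auto simp: div_add1_eq)
  obtain c t where ct: "p = (c, t)" by (cases p)
  have "3 ^ k * t \<le> 3 ^ k * 2" using p ct by (intro mult_left_mono) auto
  moreover have "0 \<le> 3 ^ k * t" "0 \<le> c" "c < 3 ^ k" using p ct by auto
  ultimately show "(case p of (c, t) \<Rightarrow> c + 3 ^ k * t) \<in> {0..<3 ^ Suc k}"
    unfolding ct by (simp only: prod.case atLeastLessThan_iff power_Suc) linarith
qed auto

text \<open>The construction depends on the threshold \<open>lam\<close>, which is chosen later in terms of the height of the level set. The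
  condition on \<open>L\<close> leaves room for translations by \<open>3^(L-2k)\<close> at all scales \<open>k\<close> in use.\<close>

locale pruning =
  fixes L J :: nat and a :: "int \<Rightarrow> complex" and lam :: real
  assumes scale: "2 * J \<le> L" and lam: "0 < lam"
begin

text \<open>At the finest scale \<open>J\<close> a packet is one term of the exponential sum. The packet of a coarser residue class is the
  sum of the packets of its three subclasses, set to 0 at the points where this sum exceeds \<open>lam\<close>. Removing whole
  values keeps the packet equivariant, as the modulus of the sum is invariant under the dual group.\<close>

function packet :: "nat \<Rightarrow> int \<Rightarrow> int \<Rightarrow> int \<Rightarrow> complex" where
  "packet k c x y =
    (if J \<le> k then a c * chi (3 ^ L) (c * x + c\<^sup>2 * y)
     else let z = \<Sum>t\<in>{0..<3}. packet (Suc k) (c + 3 ^ k * t) x y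
       in if cmod z \<le> lam then z else 0)"
  by pat_completeness auto
termination by (relation "Wellfounded.measure (\<lambda>(k, _). J - k)") auto

declare packet.simps [simp del]

definition merged :: "nat \<Rightarrow> int \<Rightarrow> int \<Rightarrow> int \<Rightarrow> complex"
  where "merged k c x y = (\<Sum>t\<in>{0..<3}. packet (Suc k) (c + 3 ^ k * t) x y)"

lemma packet_top: "packet J c x y = a c * chi (3 ^ L) (c * x + c\<^sup>2 * y)"
  by (simp add: packet.simps)

lemma packet_below:
  "k < J \<Longrightarrow> packet k c x y = (if cmod (merged k c x y) \<le> lam then merged k c x y else 0)"
  by (subst packet.simps) (simp add: merged_def Let_def)

lemma packet_le: "k < J \<Longrightarrow> cmod (packet k c x y) \<le> lam"
  using lam by (simp add: packet_below)

lemma packet_equivariant: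
  assumes "k \<le> J"
  shows "equivariant L k c (packet k c)"
  using assms
proof (induction k arbitrary: c rule: inc_induct)
  case base
  have "packet J c = (\<lambda>x y. a c * chi (3 ^ L) (c * x + c\<^sup>2 * y))"
    by (intro ext packet_top)
  then show ?case by (simp only: equivariant_character)
next
  case (step k)
  have "equivariant L k c (packet (Suc k) (c + 3 ^ k * t))" for t
    by (rule equivariant_coarser) (rule step.IH)
  then have "equivariant L k c (\<lambda>x y. \<Sum>t\<in>{0..<3}. packet (Suc k) (c + 3 ^ k * t) x y)"
    by (intro equivariant_sum)
  from equivariant_truncate[OF this]
  have "equivariant L k c (\<lambda>x y. if cmod (merged k c x y) \<le> lam then merged k c x y else 0)"
    by (simp only: merged_def)
  moreover have "packet k c = (\<lambda>x y. if cmod (merged k c x y) \<le> lam then merged k c x y else 0)"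
    by (intro ext packet_below step.hyps)
  ultimately show ?case by (simp only:)
qed

definition square_function :: "nat \<Rightarrow> int \<Rightarrow> int \<Rightarrow> real"
  where "square_function k x y = (\<Sum>c\<in>{0..<3 ^ k}. (cmod (packet k c x y))\<^sup>2)"

definition mass :: real
  where "mass = (\<Sum>c\<in>{0..<3 ^ J}. (cmod (a c))\<^sup>2)"

lemma mass_nonneg: "0 \<le> mass"
  by (simp add: mass_def sum_nonneg)

lemma square_function_top: "square_function J x y = mass"
  by (simp add: square_function_def mass_def packet_top norm_mult)

lemma square_function_nonneg: "0 \<le> square_function k x y"
  by (simp add: square_function_def sum_nonneg)

lemma square_function_Suc:
  "square_function (Suc k) x y =
    (\<Sum>c\<in>{0..<3 ^ k}. \<Sum>t\<in>{0..<3}. (cmod (packet (Suc k) (c + 3 ^ k * t) x y))\<^sup>2)"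
  unfolding square_function_def sum_base_three_split ..

lemma square_function_box:
  assumes "l \<le> k" "k \<le> J"
  shows "square_function k (x + 3 ^ (L - l) * s) (y + 3 ^ (L - l) * t) = square_function k x y"
  unfolding square_function_def
  using equivariant_cmod_box[OF packet_equivariant[OF assms(2)] assms(1)] assms scale by simp

lemma square_function_periodic:
  assumes "k \<le> J"
  shows "square_function k (x + int (3 ^ L) * s) (y + int (3 ^ L) * t) = square_function k x y"
  using square_function_box[of 0 k] assms by simp

text \<open>Before the truncation, which only decreases the modulus, a packet is a sum over three subclasses that become
  orthogonal under the average over the translations of \<open>smooth\<close>.\<close>

lemma smooth_square_function_le:
  assumes k: "k < J"
  shows "smooth L k (square_function k) x y \<le> square_function (Suc k) x y"
proof -
  have "(\<Sum>j\<in>{0..<3}. (cmod (merged k c (x + 3 ^ (L - Suc k) * j) y))\<^sup>2) =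
      3 * (\<Sum>t\<in>{0..<3}. (cmod (packet (Suc k) (c + 3 ^ k * t) x y))\<^sup>2)" for c
  proof -
    have "packet (Suc k) (c + 3 ^ k * t) (x + 3 ^ (L - Suc k) * j) y =
        packet (Suc k) (c + 3 ^ k * t) x y * (chi (3 ^ Suc k) (c * j) * chi 3 (t * j))" for t j
    proof -
      have "packet (Suc k) (c + 3 ^ k * t) (x + 3 ^ (L - Suc k) * j) y =
        chi (3 ^ Suc k) (c * j + int (3 ^ k) * (t * j)) * packet (Suc k) (c + 3 ^ k * t) x y"
        using equivariant_box[OF packet_equivariant, of "Suc k" "c + 3 ^ k * t" x j y 0] k scale
        by (simp add: distrib_right mult.assoc)
      also have "chi (3 ^ Suc k) (c * j + int (3 ^ k) * (t * j)) = chi (3 ^ Suc k) (c * j) * chi 3 (t * j)"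
        using chi_mult_left[of "3 ^ k" 3 "t * j"] by (simp only: chi_add power_Suc2) simp
      finally show ?thesis by (simp only: mult.commute)
    qed
    then show ?thesis
      unfolding merged_def by (simp only: parseval_mod_three[of "\<lambda>j. chi (3 ^ Suc k) (c * j)", OF norm_chi])
  qed
  note average = this
  have "smooth L k (square_function k) x y =
      1 / 3 * (\<Sum>j\<in>{0..<3}. \<Sum>c\<in>{0..<3 ^ k}. (cmod (packet k c (x + 3 ^ (L - Suc k) * j) y))\<^sup>2)"
    unfolding smooth_def square_function_def ..
  also have "\<dots> \<le> 1 / 3 * (\<Sum>j\<in>{0..<3}. \<Sum>c\<in>{0..<3 ^ k}. (cmod (merged k c (x + 3 ^ (L - Suc k) * j) y))\<^sup>2)"
    by (intro mult_left_mono sum_mono) (auto simp: packet_below[OF k])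
  also have "\<dots> = square_function (Suc k) x y"
    unfolding square_function_Suc by (subst sum.swap) (simp add: average flip: sum_distrib_left)
  finally show ?thesis .
qed

lemma grid_sum_square_function_le:
  assumes "k \<le> J"
  shows "grid_sum (3 ^ L) (square_function k) \<le> (real (3 ^ L))\<^sup>2 * mass"
  using assms
proof (induction k rule: inc_induct)
  case base
  show ?case unfolding square_function_top[abs_def] grid_sum_const ..
next
  case (step k)
  have "grid_sum (3 ^ L) (square_function k) = grid_sum (3 ^ L) (smooth L k (square_function k))"
    using step.hyps by (intro grid_sum_smooth[symmetric] square_function_periodic) simp
  also have "\<dots> \<le> grid_sum (3 ^ L) (square_function (Suc k))"
    by (intro grid_sum_mono smooth_square_function_le step.hyps)
  finally show ?case using step.IH by simp
qed

text \<open>Orthogonality leaves the fourth moments of the packets. Truncation turns each into a second moment at the cost of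
  \<open>lam\<^sup>2\<close>, and the total mass does not increase from fine to coarse scales.\<close>

lemma grid_sum_high_le:
  assumes k: "k < J"
  shows "grid_sum (3 ^ L) (\<lambda>x y. (square_function k x y - smooth L k (square_function k) x y)\<^sup>2)
    \<le> 2 * lam\<^sup>2 * ((real (3 ^ L))\<^sup>2 * mass)"
proof -
  have "grid_sum (3 ^ L) (\<lambda>x y. (square_function k x y - smooth L k (square_function k) x y)\<^sup>2)
     \<le> 2 * grid_sum (3 ^ L) (\<lambda>x y. \<Sum>c\<in>{0..<3 ^ k}. ((cmod (packet k c x y))\<^sup>2)\<^sup>2)"
    unfolding square_function_def[abs_def]
    using k scale
    by (intro grid_sum_high_square_function_le dual_invariant_cmod packet_equivariant) auto
  also have "\<dots> \<le> 2 * grid_sum (3 ^ L) (\<lambda>x y. lam\<^sup>2 * square_function k x y)"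
  proof (intro mult_left_mono grid_sum_mono)
    fix x y
    have "((cmod (packet k c x y))\<^sup>2)\<^sup>2 \<le> lam\<^sup>2 * (cmod (packet k c x y))\<^sup>2" for c
      unfolding power2_eq_square[of "_\<^sup>2"]
      by (intro mult_right_mono power_mono packet_le k) auto
    then show "(\<Sum>c\<in>{0..<3 ^ k}. ((cmod (packet k c x y))\<^sup>2)\<^sup>2) \<le> lam\<^sup>2 * square_function k x y"
      unfolding square_function_def sum_distrib_left by (intro sum_mono)
  qed simp
  also have "\<dots> = 2 * lam\<^sup>2 * grid_sum (3 ^ L) (square_function k)"
    by (simp add: grid_sum_cmult)
  also have "\<dots> \<le> 2 * lam\<^sup>2 * ((real (3 ^ L))\<^sup>2 * mass)"
    using k by (intro mult_left_mono grid_sum_square_function_le) auto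
  finally show ?thesis .
qed

definition weighted :: "(int \<Rightarrow> complex) \<Rightarrow> nat \<Rightarrow> int \<Rightarrow> int \<Rightarrow> complex"
  where "weighted w k x y = (\<Sum>c\<in>{0..<3 ^ k}. w c * packet k c x y)"

text \<open>A packet \<open>z\<close> that is removed satisfies \<open>|z| > lam\<close>, thus \<open>|z| \<le> |z|\<^sup>2 / lam\<close>, and \<open>|z|\<^sup>2\<close> is at most three times the
  contribution of its subclasses to the next square function. The weights \<open>w\<close> serve to treat the full sum and the
  parts of it in a residue class modulo 3 at once.\<close>

lemma weighted_step:
  assumes k: "1 \<le> k" "k < J"
    and w: "\<And>c. cmod (w c) \<le> 1" "\<And>c t. w (c + 3 * t) = w c"
  shows "cmod (weighted w (Suc k) x y - weighted w k x y) \<le> 3 / lam * square_function (Suc k) x y"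
proof -
  have w': "w (c + 3 ^ k * t) = w c" for c t
    using w(2)[of c "3 ^ (k - 1) * t"] k by (cases k) (simp_all add: mult.assoc)
  have "weighted w (Suc k) x y - weighted w k x y =
     (\<Sum>c\<in>{0..<3 ^ k}. w c * (merged k c x y - packet k c x y))"
    unfolding weighted_def sum_base_three_split w' merged_def
    by (simp only: sum_subtractf right_diff_distrib sum_distrib_left)
  also have "cmod \<dots> \<le> (\<Sum>c\<in>{0..<3 ^ k}. 3 / lam * (\<Sum>t\<in>{0..<3}. (cmod (packet (Suc k) (c + 3 ^ k * t) x y))\<^sup>2))"
  proof (rule order_trans[OF norm_sum], rule sum_mono)
    fix c
    let ?m = "cmod (merged k c x y)"
    have "cmod (w c * (merged k c x y - packet k c x y)) \<le> cmod (merged k c x y - packet k c x y)"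
      using mult_right_mono[OF w(1)[of c]] by (simp add: norm_mult)
    also have "\<dots> \<le> ?m\<^sup>2 / lam"
    proof (cases "?m \<le> lam")
      case False
      then have "?m * lam \<le> ?m\<^sup>2" by (simp add: power2_eq_square mult_left_mono)
      then show ?thesis using False lam k(2) by (simp add: packet_below field_simps)
    qed (use lam k in \<open>simp add: packet_below\<close>)
    also have "?m\<^sup>2 \<le> 3 * (\<Sum>t\<in>{0..<3}. (cmod (packet (Suc k) (c + 3 ^ k * t) x y))\<^sup>2)"
    proof -
      have "?m\<^sup>2 \<le> (\<Sum>t\<in>{0..<3}. cmod (packet (Suc k) (c + 3 ^ k * t) x y))\<^sup>2"
        unfolding merged_def by (intro power_mono norm_sum) simp
      also have "\<dots> \<le> 3 * (\<Sum>t\<in>{0..<3}. (cmod (packet (Suc k) (c + 3 ^ k * t) x y))\<^sup>2)"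
        using sum_squared_le_sum_of_squares[of "\<lambda>t. cmod (packet (Suc k) (c + 3 ^ k * t) x y)" "{0..<3}"] by simp
      finally show ?thesis .
    qed
    finally show "cmod (w c * (merged k c x y - packet k c x y)) \<le>
        3 / lam * (\<Sum>t\<in>{0..<3}. (cmod (packet (Suc k) (c + 3 ^ k * t) x y))\<^sup>2)"
      using lam by (simp add: divide_right_mono)
  qed
  also have "\<dots> = 3 / lam * square_function (Suc k) x y"
    unfolding square_function_Suc sum_distrib_left ..
  finally show ?thesis .
qed

end

section \<open>The level sets of the broad part\<close>

definition exp_sum :: "int set \<Rightarrow> (int \<Rightarrow> complex) \<Rightarrow> nat \<Rightarrow> int \<Rightarrow> int \<Rightarrow> complex"
  where "exp_sum S a N x y = (\<Sum>n\<in>S. a n * chi N (n * x + n\<^sup>2 * y))"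

definition residues :: "nat \<Rightarrow> int \<Rightarrow> int set"
  where "residues k i = {c \<in> {0..<3 ^ k}. c mod 3 = i}"

definition broad :: "real \<Rightarrow> nat \<Rightarrow> nat \<Rightarrow> (int \<Rightarrow> complex) \<Rightarrow> int \<Rightarrow> int \<Rightarrow> bool"
  where "broad A J N a x y \<longleftrightarrow> (\<forall>i\<in>{0..<3}.
    (1 + 1 / A) * cmod (exp_sum (residues J i) a N x y) \<le> cmod (exp_sum {0..<3 ^ J} a N x y))"

lemma one_plus_inverse_power_le:
  fixes A :: real
  assumes "1 \<le> A" "real n \<le> A"
  shows "(1 + 1 / A) ^ n \<le> 3"
proof -
  have "(1 + 1 / A) ^ n \<le> exp (1 / A) ^ n"
    using assms by (intro power_mono exp_ge_add_one_self) auto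
  also have "\<dots> = exp (real n / A)" by (simp flip: exp_of_nat_mult)
  also have "\<dots> \<le> exp 1" using assms by (simp add: divide_le_eq)
  also have "\<dots> \<le> 3" by (rule exp_le)
  finally show ?thesis .
qed

context pruning
begin

definition residue_part :: "int \<Rightarrow> nat \<Rightarrow> int \<Rightarrow> int \<Rightarrow> complex"
  where "residue_part i = weighted (\<lambda>c. of_bool (c mod 3 = i))"

lemma residue_part_eq_sum:
  "residue_part i k x y = (\<Sum>c\<in>residues k i. packet k c x y)"
proof -
  have "residue_part i k x y = (\<Sum>c\<in>{0..<3 ^ k}. if c mod 3 = i then packet k c x y else 0)"
    unfolding residue_part_def weighted_def by (intro sum.cong refl) simp
  then show ?thesis by (simp only: residues_def sum.inter_filter finite_atLeastLessThan_int)
qed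

lemma residue_part_top: "residue_part i J = exp_sum (residues J i) a (3 ^ L)"
  by (intro ext) (simp add: residue_part_eq_sum exp_sum_def packet_top)

text \<open>In the application \<open>w\<close> is the indicator of the points for which \<open>k\<close> is the finest scale with a large high part.\<close>

lemma bilinear_high_bound:
  assumes k: "k < J" and ij: "i \<noteq> j"
    and w: "\<And>x y. 0 \<le> w x y"
      "\<And>x y s t. w (x + 3 ^ (L - k) * s) (y + 3 ^ (L - k) * t) = w x y"
    and high: "\<And>x y. w x y * (square_function k x y)\<^sup>2 \<le>
      B * (square_function k x y - smooth L k (square_function k) x y)\<^sup>2"
    and B: "0 \<le> B"
  shows "grid_sum (3 ^ L) (\<lambda>x y. w x y * (cmod (residue_part i k x y * residue_part j k x y))\<^sup>2)
    \<le> B * (2 * lam\<^sup>2 * ((real (3 ^ L))\<^sup>2 * mass))"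
proof -
  let ?S = "\<lambda>i x y. \<Sum>c\<in>{c \<in> {0..<3 ^ k}. c mod 3 = i}. (cmod (packet k c x y))\<^sup>2"
  have S: "0 \<le> ?S i x y" "?S i x y \<le> square_function k x y" for i x y
    unfolding square_function_def by (intro sum_nonneg sum_mono2; auto)+
  have "grid_sum (3 ^ L) (\<lambda>x y. w x y * (cmod (residue_part i k x y * residue_part j k x y))\<^sup>2) =
      grid_sum (3 ^ L) (\<lambda>x y. w x y * (?S i x y * ?S j x y))"
    unfolding residue_part_eq_sum residues_def using k scale
    by (intro bilinear_local_orthogonality ij w packet_equivariant) auto
  also have "\<dots> \<le> grid_sum (3 ^ L) (\<lambda>x y. w x y * (square_function k x y)\<^sup>2)"
    unfolding power2_eq_square[of "square_function k x y" for x y]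
    by (intro grid_sum_mono mult_left_mono mult_mono S w square_function_nonneg)
  also have "\<dots> \<le> grid_sum (3 ^ L) (\<lambda>x y. B * (square_function k x y - smooth L k (square_function k) x y)\<^sup>2)"
    by (intro grid_sum_mono high)
  also have "\<dots> \<le> B * (2 * lam\<^sup>2 * ((real (3 ^ L))\<^sup>2 * mass))"
    unfolding grid_sum_cmult by (intro mult_left_mono grid_sum_high_le k B)
  finally show ?thesis .
qed

definition low_from :: "real \<Rightarrow> nat \<Rightarrow> int \<Rightarrow> int \<Rightarrow> bool"
  where "low_from A k x y \<longleftrightarrow>
    (\<forall>l. k \<le> l \<and> l < J \<longrightarrow> square_function l x y \<le> (1 + 1 / A) * square_function (Suc l) x y)"

text \<open>The finest scale at which the square function grows by more than the factor \<open>1 + 1/A\<close>. The factor is so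
  close to 1 that up to \<open>A\<close> steps with smaller growth multiply the mass by at most 3.\<close>

definition high_at :: "real \<Rightarrow> nat \<Rightarrow> int \<Rightarrow> int \<Rightarrow> bool"
  where "high_at A k x y \<longleftrightarrow>
    (1 + 1 / A) * square_function (Suc k) x y < square_function k x y \<and> low_from A (Suc k) x y"

lemma square_function_le_mass:
  assumes A: "1 \<le> A" "real J \<le> A" and low: "low_from A k x y" and k: "k \<le> J"
  shows "square_function k x y \<le> 3 * mass"
proof -
  have "k \<le> l \<longrightarrow> square_function l x y \<le> (1 + 1 / A) ^ (J - l) * mass" if "l \<le> J" for l
    using that
  proof (induction l rule: inc_induct)
    case base
    show ?case by (simp add: square_function_top)
  next
    case (step l)
    show ?case
    proof
      assume kl: "k \<le> l"
      have "square_function l x y \<le> (1 + 1 / A) * square_function (Suc l) x y"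
        using low kl step.hyps unfolding low_from_def by blast
      also have "\<dots> \<le> (1 + 1 / A) * ((1 + 1 / A) ^ (J - Suc l) * mass)"
        using step.IH kl A by (intro mult_left_mono) auto
      also have "\<dots> = (1 + 1 / A) ^ (J - l) * mass"
        using step.hyps by (simp add: Suc_diff_Suc flip: mult.assoc power_Suc)
      finally show "square_function l x y \<le> (1 + 1 / A) ^ (J - l) * mass" .
    qed
  qed
  from this[OF k] have "square_function k x y \<le> (1 + 1 / A) ^ (J - k) * mass" by simp
  also have "\<dots> \<le> 3 * mass"
    using A by (intro mult_right_mono one_plus_inverse_power_le mass_nonneg) auto
  finally show ?thesis .
qed

lemma low_fromD: "low_from A k x y \<Longrightarrow> k \<le> l \<Longrightarrow> low_from A l x y"
  unfolding low_from_def by auto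

text \<open>Each of at most \<open>A\<close> scales contributes \<open>3 / lam\<close> times a square function, which is at most \<open>3 * mass\<close>.\<close>

lemma pruning_error:
  assumes A: "1 \<le> A" "real J \<le> A" and k: "1 \<le> k" "k \<le> J" and low: "low_from A (Suc k) x y"
    and w: "\<And>c. cmod (w c) \<le> 1" "\<And>c t. w (c + 3 * t) = w c"
  shows "cmod (weighted w J x y - weighted w k x y) \<le> 9 * A * mass / lam"
proof -
  have "k \<le> l \<longrightarrow> cmod (weighted w J x y - weighted w l x y) \<le> real (J - l) * (9 * mass / lam)" if "l \<le> J" for l
    using that
  proof (induction l rule: inc_induct)
    case (step l)
    show ?case
    proof
      assume kl: "k \<le> l"
      have "weighted w J x y - weighted w l x y = (weighted w J x y - weighted w (Suc l) x y) +
          (weighted w (Suc l) x y - weighted w l x y)" by simp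
      also have "cmod \<dots> \<le> real (J - Suc l) * (9 * mass / lam) + 3 / lam * square_function (Suc l) x y"
        using step.IH kl k step.hyps
        by (intro norm_triangle_mono weighted_step w) auto
      also have "\<dots> \<le> real (J - Suc l) * (9 * mass / lam) + 3 / lam * (3 * mass)"
        using step.hyps kl lam A
        by (intro add_left_mono mult_left_mono square_function_le_mass[of A] low_fromD[OF low]) auto
      also have "\<dots> = real (J - l) * (9 * mass / lam)"
        using step.hyps(2) lam by (simp add: field_simps of_nat_diff)
      finally show "cmod (weighted w J x y - weighted w l x y) \<le> real (J - l) * (9 * mass / lam)" .
    qed
  qed simp
  from this[OF k(2)] have "cmod (weighted w J x y - weighted w k x y) \<le> real (J - k) * (9 * mass / lam)" by simp
  also have "\<dots> \<le> A * (9 * mass / lam)"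
    using A lam mass_nonneg by (intro mult_right_mono) auto
  finally show ?thesis by (simp add: mult_ac)
qed

abbreviation whole :: "int \<Rightarrow> int \<Rightarrow> complex"
  where "whole \<equiv> exp_sum {0..<3 ^ J} a (3 ^ L)"

lemma whole_eq_weighted: "whole x y = weighted (\<lambda>c. 1) J x y"
  by (simp add: exp_sum_def weighted_def packet_top)

lemma weighted_one_eq_residue_parts: "weighted (\<lambda>c. 1) k x y = (\<Sum>i\<in>{0..<3}. residue_part i k x y)"
proof -
  have "(\<Sum>i\<in>{0..<3::int}. of_bool (c mod 3 = i) * z) = z" for c and z :: complex
  proof -
    have "(\<Sum>i\<in>{0..<3::int}. of_bool (c mod 3 = i) * z) = (\<Sum>i\<in>{0..<3}. if c mod 3 = i then z else 0)"
      by (intro sum.cong) auto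
    then show ?thesis by (simp add: sum.delta)
  qed
  then show ?thesis
    unfolding residue_part_def weighted_def by (subst sum.swap) simp
qed

text \<open>The largest of the three parts has at least a third of the modulus. As it falls short of the whole sum by
  the factor \<open>1 + 1/A\<close>, the other two have to supply the difference.\<close>

lemma broad_two_large_parts:
  assumes A: "1 \<le> A" and b: "broad A J (3 ^ L) a x y"
  obtains i j where "i \<in> {0..<3}" "j \<in> {0..<3}" "i \<noteq> j"
    "cmod (whole x y) / 3 \<le> cmod (residue_part i J x y)"
    "cmod (whole x y) / (4 * A) \<le> cmod (residue_part j J x y)"
proof -
  let ?v = "cmod (whole x y)" and ?u = "\<lambda>i. cmod (residue_part i J x y)"
  have 012: "{0..<3::int} = {0, 1, 2}" by auto
  have whole: "whole x y = residue_part 0 J x y + residue_part 1 J x y + residue_part 2 J x y"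
    unfolding whole_eq_weighted weighted_one_eq_residue_parts 012 by simp
  have total: "?v \<le> ?u 0 + ?u 1 + ?u 2"
    using norm_triangle_ineq[of "residue_part 0 J x y + residue_part 1 J x y" "residue_part 2 J x y"]
      norm_triangle_ineq[of "residue_part 0 J x y" "residue_part 1 J x y"]
    unfolding whole by linarith
  have rest: "?v / (2 * A) \<le> ?v - ?u i" if "i \<in> {0..<3}" for i
  proof -
    have "(A + 1) * ?u i \<le> A * ?v"
      using b that A unfolding broad_def residue_part_top by (auto simp: field_simps)
    then have "?v \<le> (A + 1) * (?v - ?u i)" by (simp add: algebra_simps)
    also have "\<dots> \<le> (2 * A) * (?v - ?u i)"
    proof (intro mult_right_mono)
      have "?u i \<le> (1 + 1 / A) * ?u i" using A by (simp add: mult_le_cancel_right1)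
      then show "0 \<le> ?v - ?u i" using b that unfolding broad_def residue_part_top by force
    qed (use A in simp)
    finally show ?thesis using A by (simp add: divide_le_eq mult.commute)
  qed
  have pick: "\<exists>j\<in>{0..<3}. j \<noteq> i \<and> ?v / (4 * A) \<le> ?u j" if i: "i \<in> {0..<3}" for i
  proof (rule ccontr)
    assume "\<not> ?thesis"
    then have lt: "?u j < ?v / (4 * A)" if "j \<in> {0..<3}" "j \<noteq> i" for j using that by force
    have half: "?v / (2 * A) = 2 * (?v / (4 * A))" by simp
    have others: "i \<noteq> 0 \<Longrightarrow> ?u 0 < ?v / (4 * A)" "i \<noteq> 1 \<Longrightarrow> ?u 1 < ?v / (4 * A)"
      "i \<noteq> 2 \<Longrightarrow> ?u 2 < ?v / (4 * A)"
      by (rule lt; simp)+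
    have "i = 0 \<or> i = 1 \<or> i = 2" using i unfolding 012 by simp
    then show False
    proof (elim disjE)
      assume "i = 0"
      then have "?u 1 < ?v / (4 * A)" "?u 2 < ?v / (4 * A)" "?v / (2 * A) \<le> ?v - ?u 0"
        using others rest[OF i] by simp_all
      then show False using total half by linarith
    next
      assume "i = 1"
      then have "?u 0 < ?v / (4 * A)" "?u 2 < ?v / (4 * A)" "?v / (2 * A) \<le> ?v - ?u 1"
        using others rest[OF i] by simp_all
      then show False using total half by linarith
    next
      assume "i = 2"
      then have "?u 0 < ?v / (4 * A)" "?u 1 < ?v / (4 * A)" "?v / (2 * A) \<le> ?v - ?u 2"
        using others rest[OF i] by simp_all
      then show False using total half by linarith
    qed
  qed
  have "?v / 3 \<le> ?u 0 \<or> ?v / 3 \<le> ?u 1 \<or> ?v / 3 \<le> ?u 2"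
    using total by linarith
  then have "\<exists>i\<in>{0..<3}. ?v / 3 \<le> ?u i"
    unfolding 012 by simp
  then show ?thesis using pick that by blast
qed

lemma weighted_one_power2_le: "(cmod (weighted (\<lambda>c. 1) 1 x y))\<^sup>2 \<le> 3 * square_function 1 x y"
proof -
  have "(cmod (weighted (\<lambda>c. 1) 1 x y))\<^sup>2 \<le> (\<Sum>c\<in>{0..<3}. cmod (packet 1 c x y))\<^sup>2"
    unfolding weighted_def by (intro power_mono) (simp_all add: norm_sum)
  also have "\<dots> \<le> 3 * square_function 1 x y"
    using sum_squared_le_sum_of_squares[of "\<lambda>c. cmod (packet 1 c x y)" "{0..<3}"]
    by (simp add: square_function_def)
  finally show ?thesis .
qed

text \<open>The value of \<open>lam\<close> makes the pruning error \<open>\<alpha> / (8 A)\<close>, half of the lower bound \<open>\<alpha> / (4 A)\<close> for the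
  second largest part. If there were no high scale, the sum pruned down to scale 1 would be at most
  \<open>3 * sqrt mass\<close>, less than \<open>7/8 * \<alpha>\<close>.\<close>

lemma broad_point_has_high_scale:
  assumes A: "1 \<le> A" "real J \<le> A" and J: "1 \<le> J"
    and \<alpha>: "0 < \<alpha>" "12 * mass \<le> \<alpha>\<^sup>2" and mass: "0 < mass" and lam_eq: "lam = 72 * A\<^sup>2 * mass / \<alpha>"
    and b: "broad A J (3 ^ L) a x y" and large: "\<alpha> \<le> cmod (whole x y)"
  obtains k i j where "k \<in> {1..<J}" "high_at A k x y" "i \<in> {0..<3}" "j \<in> {0..<3}" "i \<noteq> j"
    "(\<alpha>\<^sup>2 / (48 * A))\<^sup>2 \<le> (cmod (residue_part i k x y * residue_part j k x y))\<^sup>2"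
proof -
  have err: "9 * A * mass / lam = \<alpha> / (8 * A)"
    using A \<alpha> mass unfolding lam_eq by (simp add: field_simps power2_eq_square)
  have err_le: "\<alpha> / (8 * A) \<le> \<alpha> / 8"
    using A \<alpha> by (intro divide_left_mono) auto
  have "\<not> low_from A 1 x y"
  proof
    assume low: "low_from A 1 x y"
    let ?W = "cmod (weighted (\<lambda>c. 1) 1 x y)"
    have "cmod (weighted (\<lambda>c. 1) J x y - weighted (\<lambda>c. 1) 1 x y) \<le> \<alpha> / 8"
      using pruning_error[OF A _ J low_fromD[OF low], of "\<lambda>c. 1"] err err_le by simp
    then have "7 / 8 * \<alpha> \<le> ?W"
      using large norm_triangle_ineq2[of "whole x y" "weighted (\<lambda>c. 1) 1 x y"]
      unfolding whole_eq_weighted by linarith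
    then have "(7 / 8 * \<alpha>)\<^sup>2 \<le> ?W\<^sup>2" using \<alpha> by (intro power_mono) auto
    also have "\<dots> \<le> 9 * mass"
      using weighted_one_power2_le[of x y] square_function_le_mass[OF A low J] by linarith
    finally show False using \<alpha> mass by (simp add: power_mult_distrib power2_eq_square)
  qed
  then obtain l where l: "l \<in> {1..<J}" "\<not> square_function l x y \<le> (1 + 1 / A) * square_function (Suc l) x y"
    unfolding low_from_def by auto
  define bad where "bad = {l \<in> {1..<J}. \<not> square_function l x y \<le> (1 + 1 / A) * square_function (Suc l) x y}"
  define k where "k = Max bad"
  have fin: "finite bad" and "bad \<noteq> {}" using l by (auto simp: bad_def)
  then have "k \<in> bad" unfolding k_def by (rule Max_in)
  then have k: "k \<in> {1..<J}" "(1 + 1 / A) * square_function (Suc k) x y < square_function k x y"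
    by (auto simp: bad_def)
  have low: "low_from A (Suc k) x y"
    unfolding low_from_def
  proof (intro allI impI, rule ccontr)
    fix m assume m: "Suc k \<le> m \<and> m < J" "\<not> square_function m x y \<le> (1 + 1 / A) * square_function (Suc m) x y"
    then have "m \<in> bad" using k by (auto simp: bad_def)
    then have "m \<le> k" unfolding k_def using fin by (rule Max_ge[rotated])
    then show False using m by simp
  qed
  have close: "cmod (residue_part i J x y) - \<alpha> / (8 * A) \<le> cmod (residue_part i k x y)" for i
  proof -
    have "cmod (residue_part i J x y - residue_part i k x y) \<le> \<alpha> / (8 * A)"
      unfolding residue_part_def err[symmetric]
      using k by (intro pruning_error A low) auto
    then show ?thesis
      using norm_triangle_ineq2[of "residue_part i J x y" "residue_part i k x y"] by linarith
  qed
  obtain i j where ij: "i \<in> {0..<3}" "j \<in> {0..<3}" "i \<noteq> j"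
    "cmod (whole x y) / 3 \<le> cmod (residue_part i J x y)"
    "cmod (whole x y) / (4 * A) \<le> cmod (residue_part j J x y)"
    using broad_two_large_parts[OF A(1) b] .
  have i: "\<alpha> / 6 \<le> cmod (residue_part i k x y)"
    using close[of i] ij(4) err_le large \<alpha> by linarith
  have "\<alpha> / (4 * A) \<le> cmod (whole x y) / (4 * A)"
    using large A by (intro divide_right_mono) auto
  moreover have "\<alpha> / (4 * A) = 2 * (\<alpha> / (8 * A))" by simp
  ultimately have j: "\<alpha> / (8 * A) \<le> cmod (residue_part j k x y)"
    using close[of j] ij(5) by linarith
  have "\<alpha>\<^sup>2 / (48 * A) = \<alpha> / 6 * (\<alpha> / (8 * A))" by (simp add: power2_eq_square)
  also have "\<dots> \<le> cmod (residue_part i k x y * residue_part j k x y)"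
    unfolding norm_mult using i j \<alpha> A by (intro mult_mono) auto
  finally have "(\<alpha>\<^sup>2 / (48 * A))\<^sup>2 \<le> (cmod (residue_part i k x y * residue_part j k x y))\<^sup>2"
    using A by (intro power_mono) auto
  then show ?thesis using that k low ij(1-3) unfolding high_at_def by blast
qed

lemma high_at_box:
  assumes "k < J"
  shows "high_at A k (x + 3 ^ (L - k) * s) (y + 3 ^ (L - k) * t) = high_at A k x y"
proof -
  have "square_function l (x + 3 ^ (L - k) * s) (y + 3 ^ (L - k) * t) = square_function l x y"
    if "k \<le> l" "l \<le> J" for l
    using that by (rule square_function_box)
  then show ?thesis
    using assms unfolding high_at_def low_from_def by (auto simp: Suc_le_eq)
qed

lemma high_at_square_function_le:
  assumes A: "1 \<le> A" and k: "k < J"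
  shows "of_bool (high_at A k x y) * (square_function k x y)\<^sup>2 \<le>
    4 * A\<^sup>2 * (square_function k x y - smooth L k (square_function k) x y)\<^sup>2"
proof (cases "high_at A k x y")
  case True
  let ?g = "square_function k x y" and ?p = "smooth L k (square_function k) x y"
  have "(1 + 1 / A) * ?p \<le> (1 + 1 / A) * square_function (Suc k) x y"
    using A by (intro mult_left_mono smooth_square_function_le k) auto
  also have "\<dots> \<le> ?g" using True by (simp add: high_at_def)
  finally have "(A + 1) * ?p \<le> A * ?g"
    using A by (simp add: field_simps)
  then have 1: "?g \<le> (A + 1) * (?g - ?p)" by (simp add: algebra_simps)
  then have "0 \<le> ?g - ?p"
    using square_function_nonneg[of k x y] A by (smt (verit) mult_pos_neg)
  then have "(A + 1) * (?g - ?p) \<le> (2 * A) * (?g - ?p)"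
    using A by (intro mult_right_mono) auto
  with 1 have "?g \<le> 2 * A * (?g - ?p)" by linarith
  then have "?g\<^sup>2 \<le> (2 * A * (?g - ?p))\<^sup>2"
    by (intro power_mono square_function_nonneg)
  then show ?thesis using True by (simp add: power_mult_distrib)
qed simp

text \<open>The powers of \<open>A\<close>: two from the smaller factor of the bilinear product, two from the high part being only the
  fraction \<open>1 / (2 A)\<close> of the square function, four from \<open>lam\<^sup>2\<close>, and one from the number of scales.\<close>

lemma broad_level_set_bound:
  assumes A: "1 \<le> A" "real J \<le> A" and J: "1 \<le> J"
    and \<alpha>: "0 < \<alpha>" "12 * mass \<le> \<alpha>\<^sup>2" and mass: "0 < mass" and lam_eq: "lam = 72 * A\<^sup>2 * mass / \<alpha>"
  shows "\<alpha> ^ 6 * grid_sum (3 ^ L) (\<lambda>x y. of_bool (broad A J (3 ^ L) a x y \<and> \<alpha> \<le> cmod (whole x y)))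
    \<le> 10 ^ 9 * A ^ 9 * ((real (3 ^ L))\<^sup>2 * mass ^ 3)"
proof -
  let ?P = "\<lambda>x y. broad A J (3 ^ L) a x y \<and> \<alpha> \<le> cmod (whole x y)"
  let ?b = "(\<alpha>\<^sup>2 / (48 * A))\<^sup>2"
  let ?T = "\<lambda>k i j x y. of_bool (high_at A k x y) * (cmod (residue_part i k x y * residue_part j k x y))\<^sup>2"
  let ?E = "4 * A\<^sup>2 * (2 * lam\<^sup>2 * ((real (3 ^ L))\<^sup>2 * mass))"
  have E: "0 \<le> ?E" using mass by simp
  have pt: "?b * of_bool (?P x y) \<le> (\<Sum>k\<in>{1..<J}. \<Sum>i\<in>{0..<3}. \<Sum>j\<in>{0..<3}-{i}. ?T k i j x y)" for x y
  proof (cases "?P x y")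
    case True
    then obtain k i j where k: "k \<in> {1..<J}" "high_at A k x y" "i \<in> {0..<3}" "j \<in> {0..<3}" "i \<noteq> j"
      "?b \<le> (cmod (residue_part i k x y * residue_part j k x y))\<^sup>2"
      using broad_point_has_high_scale[OF A J \<alpha> mass lam_eq] by metis
    then have "?b * of_bool (?P x y) \<le> ?T k i j x y" using True by simp
    also have "\<dots> \<le> (\<Sum>j\<in>{0..<3}-{i}. ?T k i j x y)"
      by (rule member_le_sum) (use k in auto)
    also have "\<dots> \<le> (\<Sum>i\<in>{0..<3}. \<Sum>j\<in>{0..<3}-{i}. ?T k i j x y)"
      by (rule member_le_sum[where f = "\<lambda>i. \<Sum>j\<in>{0..<3}-{i}. ?T k i j x y"]) (use k in \<open>auto intro!: sum_nonneg\<close>)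
    also have "\<dots> \<le> (\<Sum>k\<in>{1..<J}. \<Sum>i\<in>{0..<3}. \<Sum>j\<in>{0..<3}-{i}. ?T k i j x y)"
      by (rule member_le_sum[where f = "\<lambda>k. \<Sum>i\<in>{0..<3}. \<Sum>j\<in>{0..<3}-{i}. ?T k i j x y"])
         (use k in \<open>auto intro!: sum_nonneg\<close>)
    finally show ?thesis .
  qed (auto intro!: sum_nonneg)
  have term_le: "grid_sum (3 ^ L) (?T k i j) \<le> ?E" if "k \<in> {1..<J}" "j \<in> {0..<3}-{i}" for k i j
    using that A by (intro bilinear_high_bound high_at_square_function_le) (auto simp: high_at_box)
  \<comment> \<open>Chebyshev's inequality: on the level set the sum of the bilinear terms over scales and pairs of residues is at least \<open>?b\<close>.\<close>
  have "?b * grid_sum (3 ^ L) (\<lambda>x y. of_bool (?P x y)) = grid_sum (3 ^ L) (\<lambda>x y. ?b * of_bool (?P x y))"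
    by (rule grid_sum_cmult[symmetric])
  also have "\<dots> \<le> grid_sum (3 ^ L) (\<lambda>x y. \<Sum>k\<in>{1..<J}. \<Sum>i\<in>{0..<3}. \<Sum>j\<in>{0..<3}-{i}. ?T k i j x y)"
    by (intro grid_sum_mono pt)
  also have "\<dots> = (\<Sum>k\<in>{1..<J}. \<Sum>i\<in>{0..<3}. \<Sum>j\<in>{0..<3}-{i}. grid_sum (3 ^ L) (?T k i j))"
    by (simp only: grid_sum_sum)
  also have "\<dots> \<le> (\<Sum>k\<in>{1..<J}. \<Sum>i\<in>{0..<3::int}. \<Sum>j\<in>{0..<3::int}-{i}. ?E)"
    by (intro sum_mono term_le)
  also have "\<dots> \<le> (\<Sum>k\<in>{1..<J}. \<Sum>i\<in>{0..<3::int}. \<Sum>j\<in>{0..<3::int}. ?E)"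
    using E by (intro sum_mono sum_mono2) auto
  also have "\<dots> = real (J - 1) * (9 * ?E)" by simp
  also have "\<dots> \<le> A * (9 * ?E)"
    using A J E by (intro mult_right_mono) auto
  finally have main: "?b * grid_sum (3 ^ L) (\<lambda>x y. of_bool (?P x y)) \<le> A * (9 * ?E)" .
  have "\<alpha> ^ 6 * grid_sum (3 ^ L) (\<lambda>x y. of_bool (?P x y)) =
      2304 * A\<^sup>2 * \<alpha>\<^sup>2 * (?b * grid_sum (3 ^ L) (\<lambda>x y. of_bool (?P x y)))"
    using A by (simp add: power_divide power_mult_distrib flip: power_mult)
  also have "\<dots> \<le> 2304 * A\<^sup>2 * \<alpha>\<^sup>2 * (A * (9 * ?E))"
    by (intro mult_left_mono main) simp
  also have "\<dots> = 859963392 * A ^ 9 * ((real (3 ^ L))\<^sup>2 * mass ^ 3)"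
  proof -
    have "\<alpha>\<^sup>2 * lam\<^sup>2 = 5184 * A ^ 4 * mass\<^sup>2"
      using \<alpha> unfolding lam_eq by (simp add: power_divide power_mult_distrib flip: power_mult)
    moreover have "2304 * A\<^sup>2 * \<alpha>\<^sup>2 * (A * (9 * ?E)) = 165888 * A ^ 5 * ((real (3 ^ L))\<^sup>2 * mass) * (\<alpha>\<^sup>2 * lam\<^sup>2)"
      by (simp add: power2_eq_square eval_nat_numeral)
    ultimately show ?thesis
      by (simp add: power2_eq_square eval_nat_numeral)
  qed
  also have "\<dots> \<le> 10 ^ 9 * A ^ 9 * ((real (3 ^ L))\<^sup>2 * mass ^ 3)"
    using A mass by (intro mult_right_mono) auto
  finally show ?thesis .
qed

end

section \<open>Sixth moments, additive energy and the induction on scales\<close>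

lemma exp_sum_second_moment:
  assumes "J \<le> L"
  shows "grid_sum (3 ^ L) (\<lambda>x y. (cmod (exp_sum {0..<3 ^ J} a (3 ^ L) x y))\<^sup>2) =
    (real (3 ^ L))\<^sup>2 * (\<Sum>n\<in>{0..<3 ^ J}. (cmod (a n))\<^sup>2)"
  unfolding exp_sum_def
  by (rule parseval_grid_orthogonal) (use assms three_power_dvd_diff in auto)

lemma exp_sum_power2_le:
  assumes "finite S"
  shows "(cmod (exp_sum S a N x y))\<^sup>2 \<le> real (card S) * (\<Sum>n\<in>S. (cmod (a n))\<^sup>2)"
proof -
  have "cmod (exp_sum S a N x y) \<le> (\<Sum>n\<in>S. cmod (a n))"
    unfolding exp_sum_def by (rule order_trans[OF norm_sum]) (simp add: norm_mult)
  then have "(cmod (exp_sum S a N x y))\<^sup>2 \<le> (\<Sum>n\<in>S. cmod (a n))\<^sup>2"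
    by (intro power_mono) auto
  also have "\<dots> \<le> real (card S) * (\<Sum>n\<in>S. (cmod (a n))\<^sup>2)"
    using sum_squared_le_sum_of_squares[of "\<lambda>n. cmod (a n)" S] by (simp add: mult.commute)
  finally show ?thesis .
qed

lemma dyadic_scale_exists:
  fixes v b :: real
  assumes "b \<le> v" "v \<le> 2 ^ J * b" "1 \<le> J"
  shows "\<exists>j<J. 2 ^ j * b \<le> v \<and> v \<le> 2 * (2 ^ j * b)"
  using assms(3,2)
proof (induction J rule: nat_induct_at_least)
  case base
  then show ?case using assms(1) by auto
next
  case (Suc J)
  show ?case
  proof (cases "v \<le> 2 ^ J * b")
    case True
    then show ?thesis using Suc.IH less_SucI by blast
  next
    case False
    then show ?thesis using Suc.prems by (intro exI[of _ J]) auto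
  qed
qed

text \<open>Below the height \<open>sqrt (12 r)\<close> the second moment suffices. Above it, the level sets at the heights
  \<open>2^j * sqrt (12 r)\<close> with \<open>j < J\<close> are enough, because the sum is at most \<open>sqrt (3^J r)\<close>.\<close>

lemma broad_sixth_moment:
  fixes a :: "int \<Rightarrow> complex"
  assumes A: "1 \<le> A" "real J \<le> A" and J: "1 \<le> J" and L: "2 * J \<le> L"
  defines "r \<equiv> \<Sum>n\<in>{0..<3 ^ J}. (cmod (a n))\<^sup>2"
  shows "grid_sum (3 ^ L) (\<lambda>x y. of_bool (broad A J (3 ^ L) a x y) * cmod (exp_sum {0..<3 ^ J} a (3 ^ L) x y) ^ 6)
    \<le> 10 ^ 11 * A ^ 10 * ((real (3 ^ L))\<^sup>2 * r ^ 3)"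
proof -
  let ?f = "\<lambda>x y. cmod (exp_sum {0..<3 ^ J} a (3 ^ L) x y)"
  let ?B = "\<lambda>x y. broad A J (3 ^ L) a x y"
  have r: "0 \<le> r" unfolding r_def by (intro sum_nonneg) simp
  have sup: "(?f x y)\<^sup>2 \<le> 3 ^ J * r" for x y
    using exp_sum_power2_le[of "{0..<3 ^ J}" a "3 ^ L" x y] unfolding r_def by simp
  show ?thesis
  proof (cases "r = 0")
    case True
    then have "?f x y = 0" for x y using sup[of x y] by simp
    then show ?thesis using True by (simp add: grid_sum_def)
  next
    case False
    with r have r: "0 < r" by simp
    define \<alpha> where "\<alpha> j = 2 ^ j * sqrt (12 * r)" for j :: nat
    have \<alpha>: "0 < \<alpha> j" "12 * r \<le> (\<alpha> j)\<^sup>2" for j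
      using r by (simp_all add: \<alpha>_def power_mult_distrib mult_le_cancel_right1)
    have level: "\<alpha> j ^ 6 * grid_sum (3 ^ L) (\<lambda>x y. of_bool (?B x y \<and> \<alpha> j \<le> ?f x y))
        \<le> 10 ^ 9 * A ^ 9 * ((real (3 ^ L))\<^sup>2 * r ^ 3)" for j
    proof -
      interpret pruning L J a "72 * A\<^sup>2 * r / \<alpha> j"
        using L \<alpha> r A by unfold_locales auto
      have mass: "mass = r" by (simp add: mass_def r_def)
      show ?thesis
        using broad_level_set_bound[OF A J, of "\<alpha> j"] \<alpha>[of j] r unfolding mass by blast
    qed
    have pt: "of_bool (?B x y) * ?f x y ^ 6 \<le> 144 * r\<^sup>2 * (?f x y)\<^sup>2 +
        (\<Sum>j\<in>{..<J}. 64 * (\<alpha> j ^ 6 * of_bool (?B x y \<and> \<alpha> j \<le> ?f x y)))" for x y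
    proof (cases "?B x y")
      case True
      have tail: "0 \<le> (\<Sum>j\<in>{..<J}. 64 * (\<alpha> j ^ 6 * of_bool (?B x y \<and> \<alpha> j \<le> ?f x y)))"
        using \<alpha>(1) by (intro sum_nonneg) (simp add: less_imp_le)
      show ?thesis
      proof (cases "sqrt (12 * r) \<le> ?f x y")
        case small: False
        then have "?f x y \<le> sqrt (12 * r)" by simp
        then have "(?f x y)\<^sup>2 \<le> (sqrt (12 * r))\<^sup>2"
          by (intro power_mono) auto
        then have "(?f x y)\<^sup>2 \<le> 12 * r" using r by simp
        then have "((?f x y)\<^sup>2)\<^sup>2 \<le> (12 * r)\<^sup>2" by (intro power_mono) auto
        then have "((?f x y)\<^sup>2)\<^sup>2 * (?f x y)\<^sup>2 \<le> 144 * r\<^sup>2 * (?f x y)\<^sup>2"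
          by (intro mult_right_mono) (auto simp: power_mult_distrib)
        then show ?thesis using True tail by (simp flip: power_mult power_add)
      next
        case large: True
        have "?f x y \<le> 2 ^ J * sqrt (12 * r)"
        proof (rule power2_le_imp_le)
          have "(3::real) ^ J * r \<le> 4 ^ J * (12 * r)"
            using r by (intro mult_mono power_mono) auto
          also have "\<dots> = (2 ^ J * sqrt (12 * r))\<^sup>2"
            using r by (simp add: power_mult_distrib flip: power_mult) (simp add: power_mult mult.commute[of J])
          finally show "(?f x y)\<^sup>2 \<le> (2 ^ J * sqrt (12 * r))\<^sup>2" using sup[of x y] by linarith
        qed (use r in simp)
        then obtain j where j: "j < J" "\<alpha> j \<le> ?f x y" "?f x y \<le> 2 * \<alpha> j"
          using dyadic_scale_exists[OF large _ J] unfolding \<alpha>_def by blast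
        have "?f x y ^ 6 \<le> (2 * \<alpha> j) ^ 6" using j by (intro power_mono) auto
        also have "\<dots> = 64 * (\<alpha> j ^ 6 * of_bool (?B x y \<and> \<alpha> j \<le> ?f x y))"
          using j True by (simp add: power_mult_distrib)
        also have "\<dots> \<le> (\<Sum>j\<in>{..<J}. 64 * (\<alpha> j ^ 6 * of_bool (?B x y \<and> \<alpha> j \<le> ?f x y)))"
          by (rule member_le_sum) (use j \<alpha>(1) in \<open>auto simp: less_imp_le\<close>)
        finally show ?thesis using True by (simp add: add_increasing)
      qed
    next
      case False
      then show ?thesis by simp
    qed
    have "grid_sum (3 ^ L) (\<lambda>x y. of_bool (?B x y) * ?f x y ^ 6) \<le>
      144 * r\<^sup>2 * grid_sum (3 ^ L) (\<lambda>x y. (?f x y)\<^sup>2) +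
      (\<Sum>j\<in>{..<J}. 64 * (\<alpha> j ^ 6 * grid_sum (3 ^ L) (\<lambda>x y. of_bool (?B x y \<and> \<alpha> j \<le> ?f x y))))"
      using grid_sum_mono[OF pt] by (simp only: grid_sum_add grid_sum_sum grid_sum_cmult)
    also have "grid_sum (3 ^ L) (\<lambda>x y. (?f x y)\<^sup>2) = (real (3 ^ L))\<^sup>2 * r"
      unfolding r_def using L by (intro exp_sum_second_moment) simp
    also have "(\<Sum>j\<in>{..<J}. 64 * (\<alpha> j ^ 6 * grid_sum (3 ^ L) (\<lambda>x y. of_bool (?B x y \<and> \<alpha> j \<le> ?f x y))))
       \<le> (\<Sum>j\<in>{..<J}. 64 * (10 ^ 9 * A ^ 9 * ((real (3 ^ L))\<^sup>2 * r ^ 3)))"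
      by (intro sum_mono mult_left_mono level) simp
    also have "\<dots> = real J * (64 * 10 ^ 9 * A ^ 9 * ((real (3 ^ L))\<^sup>2 * r ^ 3))" by simp
    also have "\<dots> \<le> A * (64 * 10 ^ 9 * A ^ 9 * ((real (3 ^ L))\<^sup>2 * r ^ 3))"
      using A r by (intro mult_right_mono) auto
    also have "144 * r\<^sup>2 * ((real (3 ^ L))\<^sup>2 * r) + A * (64 * 10 ^ 9 * A ^ 9 * ((real (3 ^ L))\<^sup>2 * r ^ 3)) =
        (144 + 64 * 10 ^ 9 * A ^ 10) * ((real (3 ^ L))\<^sup>2 * r ^ 3)"
      by (simp add: algebra_simps eval_nat_numeral)
    also have "\<dots> \<le> 10 ^ 11 * A ^ 10 * ((real (3 ^ L))\<^sup>2 * r ^ 3)"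
    proof (intro mult_right_mono)
      have "1 \<le> A ^ 10" using A by simp
      then show "144 + 64 * 10 ^ 9 * A ^ 10 \<le> 10 ^ 11 * A ^ 10" by simp
    qed (use r in simp)
    finally show ?thesis by simp
  qed
qed

definition triple_coeff :: "(int \<Rightarrow> complex) \<Rightarrow> int \<times> int \<times> int \<Rightarrow> complex"
  where "triple_coeff a = (\<lambda>(i, j, k). a i * a j * a k)"

definition triple_sum :: "int \<times> int \<times> int \<Rightarrow> int"
  where "triple_sum = (\<lambda>(i, j, k). i + j + k)"

definition triple_square_sum :: "int \<times> int \<times> int \<Rightarrow> int"
  where "triple_square_sum = (\<lambda>(i, j, k). i\<^sup>2 + j\<^sup>2 + k\<^sup>2)"

text \<open>The sixth moment of an exponential sum expressed by its coefficients. For finite \<open>S\<close> it is a nonnegative real number, but it is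
  defined as the complex sum that Parseval's identity for the cube of the exponential sum yields.\<close>

definition sixth_energy :: "int set \<Rightarrow> (int \<Rightarrow> complex) \<Rightarrow> complex"
  where "sixth_energy S a = (\<Sum>p\<in>S \<times> S \<times> S. \<Sum>q\<in>S \<times> S \<times> S.
    if triple_sum p = triple_sum q \<and> triple_square_sum p = triple_square_sum q
    then triple_coeff a p * cnj (triple_coeff a q) else 0)"

lemma power3_sum_triples:
  fixes z :: "int \<Rightarrow> complex"
  shows "(\<Sum>n\<in>S. z n) ^ 3 = (\<Sum>p\<in>S \<times> S \<times> S. triple_coeff z p)"
proof -
  have "(\<Sum>n\<in>S. z n) ^ 3 = (\<Sum>i\<in>S. z i) * ((\<Sum>j\<in>S. z j) * (\<Sum>k\<in>S. z k))"
    by (simp add: power3_eq_cube)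
  also have "\<dots> = (\<Sum>i\<in>S. \<Sum>j\<in>S. \<Sum>k\<in>S. z i * z j * z k)"
    by (simp add: mult.assoc flip: sum_distrib_left sum_distrib_right)
  finally show ?thesis
    by (simp add: triple_coeff_def sum.cartesian_product split_def)
qed

lemma exp_sum_power3:
  "exp_sum S a N x y ^ 3 = (\<Sum>p\<in>S \<times> S \<times> S. triple_coeff a p * chi N (triple_sum p * x + triple_square_sum p * y))"
proof -
  have "triple_coeff (\<lambda>n. a n * chi N (n * x + n\<^sup>2 * y)) p =
      triple_coeff a p * chi N (triple_sum p * x + triple_square_sum p * y)" for p
  proof -
    obtain i j k where p: "p = (i, j, k)" by (metis prod_cases3)
    have "(i + j + k) * x + (i\<^sup>2 + j\<^sup>2 + k\<^sup>2) * y = (i * x + i\<^sup>2 * y) + (j * x + j\<^sup>2 * y) + (k * x + k\<^sup>2 * y)"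
      by (simp add: algebra_simps)
    then show ?thesis
      by (simp add: p triple_coeff_def triple_sum_def triple_square_sum_def chi_add)
  qed
  then show ?thesis unfolding exp_sum_def power3_sum_triples by simp
qed

text \<open>The grid is so fine that the congruences between sums of three frequencies, and between sums of three squares,
  are equalities.\<close>

lemma exp_sum_sixth_moment:
  assumes S: "S \<subseteq> {0..<3 ^ J}" and L: "2 * J + 1 \<le> L"
  shows "complex_of_real (grid_sum (3 ^ L) (\<lambda>x y. cmod (exp_sum S a (3 ^ L) x y) ^ 6)) =
    of_nat ((3 ^ L)\<^sup>2) * sixth_energy S a"
proof -
  have "cmod (exp_sum S a (3 ^ L) x y) ^ 6 =
      (cmod (\<Sum>p\<in>S \<times> S \<times> S. triple_coeff a p * chi (3 ^ L) (triple_sum p * x + triple_square_sum p * y)))\<^sup>2" for x y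
    unfolding exp_sum_power3[symmetric] by (simp add: norm_power flip: power_mult)
  then have "complex_of_real (grid_sum (3 ^ L) (\<lambda>x y. cmod (exp_sum S a (3 ^ L) x y) ^ 6)) =
    of_nat ((3 ^ L)\<^sup>2) * (\<Sum>p\<in>S \<times> S \<times> S. \<Sum>q\<in>S \<times> S \<times> S.
      if int (3 ^ L) dvd triple_sum p - triple_sum q \<and> int (3 ^ L) dvd triple_square_sum p - triple_square_sum q
      then triple_coeff a p * cnj (triple_coeff a q) else 0)"
    by (simp only: parseval_grid zero_less_power zero_less_numeral)
  also have "(\<Sum>p\<in>S \<times> S \<times> S. \<Sum>q\<in>S \<times> S \<times> S.
      if int (3 ^ L) dvd triple_sum p - triple_sum q \<and> int (3 ^ L) dvd triple_square_sum p - triple_square_sum q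
      then triple_coeff a p * cnj (triple_coeff a q) else 0) = sixth_energy S a"
    unfolding sixth_energy_def
  proof (intro sum.cong refl if_cong)
    fix p q assume pq: "p \<in> S \<times> S \<times> S" "q \<in> S \<times> S \<times> S"
    have range: "triple_sum p \<in> {0..<3 ^ (2 * J + 1)} \<and> triple_square_sum p \<in> {0..<3 ^ (2 * J + 1)}"
      if "p \<in> S \<times> S \<times> S" for p
    proof -
      obtain i j k where p: "p = (i, j, k)" by (metis prod_cases3)
      have bd: "0 \<le> n" "n < 3 ^ J" "n\<^sup>2 < (3 ^ J)\<^sup>2" if "n \<in> S" for n
        using S that by (auto intro!: power_strict_mono)
      have "i \<in> S" "j \<in> S" "k \<in> S" using that p by auto
      note bds = bd[OF this(1)] bd[OF this(2)] bd[OF this(3)]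
      have "(3::int) ^ J \<le> (3 ^ J)\<^sup>2"
        by (simp add: power2_eq_square)
      then have "0 \<le> i + j + k \<and> i + j + k < 3 * (3 ^ J)\<^sup>2 \<and> i\<^sup>2 + j\<^sup>2 + k\<^sup>2 < 3 * (3 ^ J)\<^sup>2"
        using bds by linarith
      moreover have "(3::int) ^ (2 * J + 1) = 3 * (3 ^ J)\<^sup>2"
        by (simp add: power_mult[symmetric] mult.commute)
      ultimately show ?thesis
        unfolding p triple_sum_def triple_square_sum_def by simp
    qed
    have "3 ^ L dvd u - v \<longleftrightarrow> u = v" if "u \<in> {0..<3 ^ (2 * J + 1)}" "v \<in> {0..<3 ^ (2 * J + 1)}" for u v :: int
      using three_power_dvd_diff[OF that L] by auto
    then show "(int (3 ^ L) dvd triple_sum p - triple_sum q \<and> int (3 ^ L) dvd triple_square_sum p - triple_square_sum q)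
      = (triple_sum p = triple_sum q \<and> triple_square_sum p = triple_square_sum q)"
      using range[OF pq(1)] range[OF pq(2)] by simp
  qed
  finally show ?thesis .
qed

text \<open>Sums of three terms and sums of three squares change under \<open>m \<mapsto> c + d m\<close> by an affine map with an invertible
  triangular linear part.\<close>

lemma sixth_energy_affine:
  fixes d :: int
  assumes "d \<noteq> 0"
  shows "sixth_energy ((\<lambda>m. c + d * m) ` S) a = sixth_energy S (\<lambda>m. a (c + d * m))"
proof -
  let ?h = "\<lambda>m. c + d * m"
  let ?H = "map_prod ?h (map_prod ?h ?h)"
  have "inj ?h" using assms by (simp add: inj_def)
  then have "inj ?H" by (intro prod.inj_map)
  then have inj: "inj_on ?H (S \<times> S \<times> S)" by (rule inj_on_subset) simp
  have img: "?h ` S \<times> ?h ` S \<times> ?h ` S = ?H ` (S \<times> S \<times> S)"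
    by (simp add: map_prod_surj_on[OF refl map_prod_surj_on[OF refl refl]])
  have iff: "(triple_sum (?H p) = triple_sum (?H q) \<and> triple_square_sum (?H p) = triple_square_sum (?H q)) =
     (triple_sum p = triple_sum q \<and> triple_square_sum p = triple_square_sum q)" for p q
  proof -
    have s: "triple_sum (?H p) = 3 * c + d * triple_sum p" for p
      by (cases p) (simp add: triple_sum_def algebra_simps)
    have t: "triple_square_sum (?H p) = 3 * c\<^sup>2 + 2 * c * d * triple_sum p + d\<^sup>2 * triple_square_sum p" for p
      by (cases p) (simp add: triple_sum_def triple_square_sum_def algebra_simps power2_eq_square)
    show ?thesis unfolding s t using assms by auto
  qed
  have coeff: "triple_coeff a (?H p) = triple_coeff (\<lambda>m. a (c + d * m)) p" for p
    by (cases p) (simp add: triple_coeff_def)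
  show ?thesis
    unfolding sixth_energy_def img sum.reindex[OF inj] o_def iff coeff ..
qed

lemma residues_Suc:
  assumes "i \<in> {0..<3}"
  shows "residues (Suc J) i = (\<lambda>m. i + 3 * m) ` {0..<3 ^ J}"
proof (intro equalityI subsetI)
  fix c assume "c \<in> residues (Suc J) i"
  then have c: "0 \<le> c" "c < 3 * 3 ^ J" "c mod 3 = i" by (auto simp: residues_def)
  then have "c = i + 3 * (c div 3)" "c div 3 \<in> {0..<3 ^ J}" by auto
  then show "c \<in> (\<lambda>m. i + 3 * m) ` {0..<3 ^ J}" by blast
qed (use assms in \<open>auto simp: residues_def\<close>)

definition energy_bound :: "nat \<Rightarrow> real \<Rightarrow> bool"
  where "energy_bound J D \<longleftrightarrow> (\<forall>a. Re (sixth_energy {0..<3 ^ J} a) \<le> D * (\<Sum>n\<in>{0..<3 ^ J}. (cmod (a n))\<^sup>2) ^ 3)"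

lemma energy_bound_0: "energy_bound 0 1"
proof -
  have 0: "{0..<3 ^ 0::int} = {0}" by auto
  have "Re (sixth_energy {0} a) = ((cmod (a 0))\<^sup>2) ^ 3" for a
  proof -
    let ?z = "triple_coeff a (0, 0, 0)"
    have "sixth_energy {0} a = of_real ((cmod ?z)\<^sup>2)"
      unfolding complex_norm_square by (simp add: sixth_energy_def)
    then show ?thesis
      by (simp add: triple_coeff_def norm_mult power_mult_distrib power3_eq_cube)
  qed
  then show ?thesis unfolding energy_bound_def 0 by simp
qed

text \<open>At a point that is not broad, the sum is dominated by its part in one residue class modulo 3. The frequencies
  \<open>i + 3 m\<close> of that part rescale to the frequencies \<open>m < 3^J\<close>.\<close>

lemma energy_bound_Suc:
  assumes A: "1 \<le> A" "real (Suc J) \<le> A" and D: "energy_bound J D" "0 \<le> D"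
  shows "energy_bound (Suc J) ((1 + 1 / A) ^ 6 * D + 10 ^ 11 * A ^ 10)"
  unfolding energy_bound_def
proof
  fix a :: "int \<Rightarrow> complex"
  define L where "L = 2 * Suc J + 1"
  have L: "2 * Suc J + 1 \<le> L" by (simp add: L_def)
  let ?S = "{0..<3 ^ Suc J :: int}" and ?M = "(real (3 ^ L))\<^sup>2"
  let ?f = "\<lambda>x y. cmod (exp_sum ?S a (3 ^ L) x y)"
  let ?fi = "\<lambda>i x y. cmod (exp_sum (residues (Suc J) i) a (3 ^ L) x y)"
  let ?B = "\<lambda>x y. of_bool (broad A (Suc J) (3 ^ L) a x y) * ?f x y ^ 6"
  define r where "r = (\<Sum>n\<in>?S. (cmod (a n))\<^sup>2)"
  define s where "s i = (\<Sum>m\<in>{0..<3 ^ J}. (cmod (a (i + 3 * m)))\<^sup>2)" for i :: int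
  have moment: "grid_sum (3 ^ L) (\<lambda>x y. cmod (exp_sum S a (3 ^ L) x y) ^ 6) = ?M * Re (sixth_energy S a)"
    if "S \<subseteq> ?S" for S
  proof -
    have "complex_of_real (grid_sum (3 ^ L) (\<lambda>x y. cmod (exp_sum S a (3 ^ L) x y) ^ 6)) =
        of_real ?M * sixth_energy S a"
      using exp_sum_sixth_moment[OF that, of L a] L by simp
    moreover have "Re (of_real m * z) = m * Re z" for m z by simp
    ultimately show ?thesis by (metis Re_complex_of_real)
  qed
  have pt: "?f x y ^ 6 \<le> (1 + 1 / A) ^ 6 * (\<Sum>i\<in>{0..<3}. ?fi i x y ^ 6) + ?B x y" for x y
  proof (cases "broad A (Suc J) (3 ^ L) a x y")
    case True
    then show ?thesis using A by (simp add: sum_nonneg)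
  next
    case False
    then obtain i where i: "i \<in> {0..<3}" "?f x y \<le> (1 + 1 / A) * ?fi i x y"
      unfolding broad_def by force
    have "?f x y ^ 6 \<le> ((1 + 1 / A) * ?fi i x y) ^ 6"
      using i(2) by (intro power_mono) auto
    also have "\<dots> = (1 + 1 / A) ^ 6 * ?fi i x y ^ 6" by (rule power_mult_distrib)
    also have "\<dots> \<le> (1 + 1 / A) ^ 6 * (\<Sum>i\<in>{0..<3}. ?fi i x y ^ 6)"
      using A i(1) by (intro mult_left_mono member_le_sum) auto
    finally show ?thesis using False by simp
  qed
  have "?M * Re (sixth_energy ?S a) \<le> (1 + 1 / A) ^ 6 * (\<Sum>i\<in>{0..<3}. grid_sum (3 ^ L) (\<lambda>x y. ?fi i x y ^ 6)) + grid_sum (3 ^ L) ?B"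
    unfolding moment[OF order_refl, symmetric]
    using grid_sum_mono[OF pt] by (simp only: grid_sum_add grid_sum_sum grid_sum_cmult)
  also have "(\<Sum>i\<in>{0..<3}. grid_sum (3 ^ L) (\<lambda>x y. ?fi i x y ^ 6)) \<le> (\<Sum>i\<in>{0..<3}. ?M * (D * s i ^ 3))"
  proof (rule sum_mono)
    fix i :: int assume i: "i \<in> {0..<3}"
    have "grid_sum (3 ^ L) (\<lambda>x y. ?fi i x y ^ 6) = ?M * Re (sixth_energy {0..<3 ^ J} (\<lambda>m. a (i + 3 * m)))"
      by (subst moment) (auto simp: residues_def[of "Suc J"] residues_Suc[OF i, symmetric] simp flip: sixth_energy_affine)
    also have "\<dots> \<le> ?M * (D * s i ^ 3)"
      using D(1) unfolding energy_bound_def s_def by (intro mult_left_mono) auto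
    finally show "grid_sum (3 ^ L) (\<lambda>x y. ?fi i x y ^ 6) \<le> ?M * (D * s i ^ 3)" .
  qed
  also have "grid_sum (3 ^ L) ?B \<le> 10 ^ 11 * A ^ 10 * (?M * r ^ 3)"
    unfolding r_def using A by (intro broad_sixth_moment) (auto simp: L_def)
  also have "(\<Sum>i\<in>{0..<3}. ?M * (D * s i ^ 3)) \<le> ?M * (D * r ^ 3)"
  proof -
    have s0: "0 \<le> s i" for i unfolding s_def by (intro sum_nonneg) simp
    have "r = (\<Sum>i\<in>{0..<3}. s i)"
    proof -
      have "r = (\<Sum>i\<in>{0..<3}. \<Sum>c\<in>{c \<in> ?S. c mod 3 = i}. (cmod (a c))\<^sup>2)"
        unfolding r_def by (rule sum.group[symmetric]) auto
      also have "\<dots> = (\<Sum>i\<in>{0..<3}. s i)"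
      proof (intro sum.cong refl)
        fix i :: int assume i: "i \<in> {0..<3}"
        have "{c \<in> ?S. c mod 3 = i} = (\<lambda>m. i + 3 * m) ` {0..<3 ^ J}"
          using residues_Suc[OF i, of J] by (simp only: residues_def)
        then show "(\<Sum>c\<in>{c \<in> ?S. c mod 3 = i}. (cmod (a c))\<^sup>2) = s i"
          by (simp add: s_def sum.reindex inj_on_def)
      qed
      finally show ?thesis .
    qed
    moreover have "(\<Sum>i\<in>{0..<3}. s i ^ 3) \<le> (\<Sum>i\<in>{0..<3}. s i) ^ 3"
    proof -
      have "(\<Sum>i\<in>{0..<3}. s i ^ 3) \<le> (\<Sum>i\<in>{0..<3}. s i * (\<Sum>i\<in>{0..<3}. s i)\<^sup>2)"
      proof (rule sum_mono)
        fix i :: int assume "i \<in> {0..<3}"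
        then have "s i \<le> (\<Sum>i\<in>{0..<3}. s i)" by (intro member_le_sum s0) auto
        then show "s i ^ 3 \<le> s i * (\<Sum>i\<in>{0..<3}. s i)\<^sup>2"
          unfolding power3_eq_cube power2_eq_square mult.assoc
          using s0[of i] by (intro mult_left_mono mult_mono) auto
      qed
      also have "\<dots> = (\<Sum>i\<in>{0..<3}. s i) ^ 3"
        by (simp add: power3_eq_cube power2_eq_square mult.assoc flip: sum_distrib_right)
      finally show ?thesis .
    qed
    ultimately show ?thesis
      using D(2) by (simp add: mult_left_mono flip: sum_distrib_left)
  qed
  finally have "?M * Re (sixth_energy ?S a) \<le> (1 + 1 / A) ^ 6 * (?M * (D * r ^ 3)) + 10 ^ 11 * A ^ 10 * (?M * r ^ 3)"
    using A by (simp add: mult_left_mono)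
  also have "\<dots> = ?M * (((1 + 1 / A) ^ 6 * D + 10 ^ 11 * A ^ 10) * r ^ 3)"
    by (simp add: algebra_simps)
  finally show "Re (sixth_energy ?S a) \<le> ((1 + 1 / A) ^ 6 * D + 10 ^ 11 * A ^ 10) * (\<Sum>n\<in>?S. (cmod (a n))\<^sup>2) ^ 3"
    by (simp add: r_def)
qed

lemma energy_bound_iterated:
  assumes A: "1 \<le> A"
  shows "real J \<le> A \<Longrightarrow> energy_bound J ((1 + 1 / A) ^ (6 * J) * (1 + real J * (10 ^ 11 * A ^ 10)))"
proof (induction J)
  case 0
  show ?case using energy_bound_0 by simp
next
  case (Suc J)
  let ?D = "(1 + 1 / A) ^ (6 * J) * (1 + real J * (10 ^ 11 * A ^ 10))"
  have "energy_bound (Suc J) ((1 + 1 / A) ^ 6 * ?D + 10 ^ 11 * A ^ 10)"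
    using Suc A by (intro energy_bound_Suc) auto
  moreover have "(1 + 1 / A) ^ 6 * ?D + 10 ^ 11 * A ^ 10 \<le>
      (1 + 1 / A) ^ (6 * Suc J) * (1 + real (Suc J) * (10 ^ 11 * A ^ 10))"
  proof -
    have "1 \<le> (1 + 1 / A) ^ (6 * Suc J)" using A by (intro one_le_power) auto
    then have "10 ^ 11 * A ^ 10 \<le> (1 + 1 / A) ^ (6 * Suc J) * (10 ^ 11 * A ^ 10)"
      using A by (simp add: mult_le_cancel_right1)
    then show ?thesis by (simp add: algebra_simps power_add)
  qed
  ultimately show ?case
    unfolding energy_bound_def by (meson mult_right_mono order_trans sum_nonneg zero_le_power zero_le_power2)
qed

text \<open>With \<open>A = J\<close> the product of the narrow losses is at most \<open>3^6\<close>.\<close>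

lemma energy_bound_log_power:
  assumes "1 \<le> J"
  shows "energy_bound J (10 ^ 15 * real J ^ 11)"
proof -
  have J: "1 \<le> real J" using assms by simp
  have "(1 + 1 / real J) ^ (6 * J) * (1 + real J * (10 ^ 11 * real J ^ 10)) \<le> 3 ^ 6 * (2 * (10 ^ 11 * real J ^ 11))"
  proof (intro mult_mono)
    show "(1 + 1 / real J) ^ (6 * J) \<le> 3 ^ 6"
      unfolding mult.commute[of 6] power_mult
      using J by (intro power_mono one_plus_inverse_power_le) auto
    show "1 + real J * (10 ^ 11 * real J ^ 10) \<le> 2 * (10 ^ 11 * real J ^ 11)"
      using one_le_power[OF J, of 11] by (simp add: eval_nat_numeral)
  qed (use J in auto)
  also have "\<dots> \<le> 10 ^ 15 * real J ^ 11" by simp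
  finally show ?thesis
    using energy_bound_iterated[OF J, of J]
    unfolding energy_bound_def by (meson mult_right_mono order_trans order_refl sum_nonneg zero_le_power zero_le_power2)
qed

section \<open>From the grid to the torus\<close>

lemma e_add: "e (x + y) = e x * e y"
  by (simp add: e_def distrib_left flip: exp_add)

lemma cnj_e: "cnj (e x) = e (- x)"
  by (simp add: e_def exp_cnj)

lemma continuous_on_e [continuous_intros]:
  "continuous_on S f \<Longrightarrow> continuous_on S (\<lambda>x. e (f x))"
  unfolding e_def by (intro continuous_intros)

lemma integral_e_unit_interval:
  "integral {0..1} (\<lambda>t. e (of_int m * t)) = (if m = 0 then 1 else 0)"
proof (cases "m = 0")
  case True
  then show ?thesis by (simp add: e_def)
next
  case False
  define c where "c = 2 * of_real pi * \<i> * of_int m"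
  have c: "c \<noteq> 0" using False by (simp add: c_def)
  have e: "e (of_int m * t) = exp (c * of_real t)" for t
    by (simp add: e_def c_def mult.assoc)
  have "((\<lambda>t. exp (c * of_real t)) has_integral exp (c * of_real 1) / c - exp (c * of_real 0) / c) {0..1}"
  proof (rule fundamental_theorem_of_calculus)
    fix t :: real
    have "((\<lambda>w. exp (c * w) / c) has_field_derivative exp (c * of_real t)) (at (of_real t))"
      using c by (auto intro!: derivative_eq_intros)
    then show "((\<lambda>t. exp (c * of_real t) / c) has_vector_derivative exp (c * of_real t)) (at t within {0..1})"
      by (rule has_vector_derivative_real_field)
  qed simp
  moreover have "exp c = 1"
    unfolding exp_eq_1 by (auto simp: c_def intro!: exI[of _ m])
  ultimately show ?thesis using False by (simp add: e integral_unique)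
qed

lemma has_integral_e_unit_square:
  "((\<lambda>x. e (of_int m * fst x + of_int n * snd x)) has_integral (if m = 0 \<and> n = 0 then 1 else 0))
    (cbox (0, 0) (1, 1))"
proof -
  have cont: "continuous_on (cbox (0, 0) (1, 1)) (\<lambda>x :: real \<times> real. e (of_int m * fst x + of_int n * snd x))"
    by (intro continuous_intros)
  have "integral (cbox (0, 0) (1, 1)) (\<lambda>x :: real \<times> real. e (of_int m * fst x + of_int n * snd x)) =
    integral {0..1} (\<lambda>s. integral {0..1} (\<lambda>t. e (of_int m * s) * e (of_int n * t)))"
    unfolding integral_prod_continuous[OF cont] by (simp add: e_add)
  also have "\<dots> = (if m = 0 \<and> n = 0 then 1 else 0)"
    by (simp add: integral_e_unit_interval)
  finally show ?thesis
    using integrable_integral[OF integrable_continuous[OF cont]] by simp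
qed

definition torus_sum :: "int set \<Rightarrow> (int \<Rightarrow> complex) \<Rightarrow> real \<times> real \<Rightarrow> complex"
  where "torus_sum S b x = (\<Sum>n\<in>S. b n * e (of_int n * fst x + of_int (n\<^sup>2) * snd x))"

lemma torus_sum_power6:
  "complex_of_real (cmod (torus_sum S b x) ^ 6) =
    (\<Sum>p\<in>S \<times> S \<times> S. \<Sum>q\<in>S \<times> S \<times> S. triple_coeff b p * cnj (triple_coeff b q) *
      e (of_int (triple_sum p - triple_sum q) * fst x + of_int (triple_square_sum p - triple_square_sum q) * snd x))"
proof -
  let ?E = "\<lambda>p. e (of_int (triple_sum p) * fst x + of_int (triple_square_sum p) * snd x)"
  have "triple_coeff (\<lambda>n. b n * e (of_int n * fst x + of_int (n\<^sup>2) * snd x)) p = triple_coeff b p * ?E p" for p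
  proof -
    obtain i j k where p: "p = (i, j, k)" by (metis prod_cases3)
    have "of_int (i + j + k) * fst x + of_int (i\<^sup>2 + j\<^sup>2 + k\<^sup>2) * snd x =
        (of_int i * fst x + of_int (i\<^sup>2) * snd x) + (of_int j * fst x + of_int (j\<^sup>2) * snd x) +
        (of_int k * fst x + of_int (k\<^sup>2) * snd x)"
      by (simp add: algebra_simps)
    then show ?thesis
      unfolding p triple_coeff_def triple_sum_def triple_square_sum_def prod.case
      by (simp only: e_add mult_ac)
  qed
  then have cube: "torus_sum S b x ^ 3 = (\<Sum>p\<in>S \<times> S \<times> S. triple_coeff b p * ?E p)"
    unfolding torus_sum_def power3_sum_triples by simp
  have "complex_of_real (cmod (torus_sum S b x) ^ 6) = of_real ((cmod (torus_sum S b x ^ 3))\<^sup>2)"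
    by (simp add: norm_power flip: power_mult)
  also have "\<dots> = (\<Sum>p\<in>S \<times> S \<times> S. \<Sum>q\<in>S \<times> S \<times> S. (triple_coeff b p * ?E p) * cnj (triple_coeff b q * ?E q))"
    unfolding complex_norm_square cube cnj_sum sum_product ..
  also have "\<dots> = (\<Sum>p\<in>S \<times> S \<times> S. \<Sum>q\<in>S \<times> S \<times> S. triple_coeff b p * cnj (triple_coeff b q) *
      e (of_int (triple_sum p - triple_sum q) * fst x + of_int (triple_square_sum p - triple_square_sum q) * snd x))"
  proof (intro sum.cong refl)
    fix p q
    have "of_int (triple_sum p - triple_sum q) * fst x + of_int (triple_square_sum p - triple_square_sum q) * snd x =
      (of_int (triple_sum p) * fst x + of_int (triple_square_sum p) * snd x) +
      - (of_int (triple_sum q) * fst x + of_int (triple_square_sum q) * snd x)"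
      by (simp add: algebra_simps)
    then have "e (of_int (triple_sum p - triple_sum q) * fst x + of_int (triple_square_sum p - triple_square_sum q) * snd x) =
        ?E p * cnj (?E q)"
      unfolding cnj_e e_add[symmetric] by (rule arg_cong)
    then show "(triple_coeff b p * ?E p) * cnj (triple_coeff b q * ?E q) = triple_coeff b p * cnj (triple_coeff b q) *
      e (of_int (triple_sum p - triple_sum q) * fst x + of_int (triple_square_sum p - triple_square_sum q) * snd x)"
      by (simp only: complex_cnj_mult mult_ac)
  qed
  finally show ?thesis .
qed

lemma torus_sixth_moment:
  assumes S: "finite S"
  shows "(LINT x:{0..1} \<times> {0..1}|lborel. cmod (torus_sum S b x) ^ 6) = Re (sixth_energy S b)"
proof -
  let ?Q = "cbox (0, 0) (1, 1) :: (real \<times> real) set"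
  have Q: "{0..1} \<times> {0..1} = ?Q" by (simp add: cbox_Pair_eq)
  have "((\<lambda>x. complex_of_real (cmod (torus_sum S b x) ^ 6)) has_integral sixth_energy S b) ?Q"
    unfolding torus_sum_power6 sixth_energy_def
  proof (intro has_integral_sum finite_cartesian_product S)
    fix p q
    have "(if triple_sum p = triple_sum q \<and> triple_square_sum p = triple_square_sum q
        then triple_coeff b p * cnj (triple_coeff b q) else 0) = triple_coeff b p * cnj (triple_coeff b q) *
        (if triple_sum p - triple_sum q = 0 \<and> triple_square_sum p - triple_square_sum q = 0 then 1 else 0)"
      by simp
    then show "((\<lambda>x. triple_coeff b p * cnj (triple_coeff b q) *
        e (of_int (triple_sum p - triple_sum q) * fst x + of_int (triple_square_sum p - triple_square_sum q) * snd x))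
      has_integral (if triple_sum p = triple_sum q \<and> triple_square_sum p = triple_square_sum q
        then triple_coeff b p * cnj (triple_coeff b q) else 0)) ?Q"
      by (simp only: has_integral_mult_right[OF has_integral_e_unit_square])
  qed
  from has_integral_linear[OF this bounded_linear_Re]
  have int: "((\<lambda>x. cmod (torus_sum S b x) ^ 6) has_integral Re (sixth_energy S b)) ?Q"
    by (simp only: o_def Re_complex_of_real)
  have "continuous_on ?Q (\<lambda>x. cmod (torus_sum S b x) ^ 6)"
    unfolding torus_sum_def by (intro continuous_intros)
  then have "set_integrable lborel ?Q (\<lambda>x. cmod (torus_sum S b x) ^ 6)"
    unfolding set_integrable_def by (intro borel_integrable_compact compact_cbox)
  from set_borel_integral_eq_integral(2)[OF this] int show ?thesis
    unfolding Q by (simp add: integral_unique)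
qed

lemma quadratic_exp_sum_eq_torus_sum:
  assumes M: "int M < N"
    and b_def: "\<And>n. b n = (if 1 \<le> n \<and> n \<le> int M then a (nat n) else 0)"
  shows "quadratic_exp_sum M a = torus_sum {0..<N} b"
    and "(\<Sum>n\<in>{0..<N}. (cmod (b n))\<^sup>2) = (\<Sum>n=1..M. (cmod (a n))\<^sup>2)"
proof -
  have extend: "(\<Sum>n=1..M. h (int n)) = (\<Sum>n\<in>{0..<N}. h n)"
    if "\<And>n. \<not> (1 \<le> n \<and> n \<le> int M) \<Longrightarrow> h n = 0" for h :: "int \<Rightarrow> 'a::comm_monoid_add"
  proof -
    have "(\<Sum>n=1..M. h (int n)) = (\<Sum>n\<in>{1..int M}. h n)"
      by (rule sum.reindex_bij_witness[of _ nat int]) auto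
    also have "\<dots> = (\<Sum>n\<in>{0..<N}. h n)"
      using M that by (intro sum.mono_neutral_left) auto
    finally show ?thesis .
  qed
  show "quadratic_exp_sum M a = torus_sum {0..<N} b"
  proof
    fix x
    have "quadratic_exp_sum M a x = (\<Sum>n=1..M. b (int n) * e (of_int (int n) * fst x + of_int ((int n)\<^sup>2) * snd x))"
      unfolding quadratic_exp_sum_def b_def by (intro sum.cong) auto
    also have "\<dots> = torus_sum {0..<N} b x"
      unfolding torus_sum_def by (rule extend) (auto simp: b_def)
    finally show "quadratic_exp_sum M a x = torus_sum {0..<N} b x" .
  qed
  have "(\<Sum>n=1..M. (cmod (a n))\<^sup>2) = (\<Sum>n=1..M. (cmod (b (int n)))\<^sup>2)"
    unfolding b_def by (intro sum.cong) auto
  also have "\<dots> = (\<Sum>n\<in>{0..<N}. (cmod (b n))\<^sup>2)"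
    by (rule extend) (auto simp: b_def)
  finally show "(\<Sum>n\<in>{0..<N}. (cmod (b n))\<^sup>2) = (\<Sum>n=1..M. (cmod (a n))\<^sup>2)" by simp
qed

lemma best_constant_le_of_energy_bound:
  assumes M: "1 \<le> M" "int M < 3 ^ J" and D: "energy_bound J D" "0 \<le> D"
  shows "best_constant M \<le> D powr (1 / 6)"
proof (rule best_constant_least(2)[OF M(1)])
  show "D powr (1 / 6) \<in> admissible_constants M"
    unfolding admissible_constants_def
  proof (intro CollectI allI)
    fix a :: "nat \<Rightarrow> complex"
    define b where "b n = (if 1 \<le> n \<and> n \<le> int M then a (nat n) else 0)" for n :: int
    let ?r = "\<Sum>n=1..M. (cmod (a n))\<^sup>2"
    have r: "0 \<le> ?r" by (intro sum_nonneg) simp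
    have "L6_norm (quadratic_exp_sum M a) = Re (sixth_energy {0..<3 ^ J} b) powr (1 / 6)"
      unfolding L6_norm_def quadratic_exp_sum_eq_torus_sum(1)[OF M(2) b_def]
      by (subst torus_sixth_moment) auto
    also have "\<dots> \<le> (D * ?r ^ 3) powr (1 / 6)"
    proof (rule powr_mono2)
      have "0 \<le> (LINT x:{0..1} \<times> {0..1}|lborel. cmod (torus_sum {0..<3 ^ J} b x) ^ 6)"
        unfolding set_lebesgue_integral_def by (intro integral_nonneg_AE) auto
      then show "0 \<le> Re (sixth_energy {0..<3 ^ J} b)"
        by (subst (asm) torus_sixth_moment) auto
      show "Re (sixth_energy {0..<3 ^ J} b) \<le> D * ?r ^ 3"
        using D(1) quadratic_exp_sum_eq_torus_sum(2)[OF M(2) b_def]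
        unfolding energy_bound_def by metis
    qed simp
    also have "\<dots> = D powr (1 / 6) * sqrt ?r"
    proof -
      have "(?r ^ 3) powr (1 / 6) = sqrt ?r"
      proof (cases "?r = 0")
        case False
        with r have "0 < ?r" by simp
        then show ?thesis by (simp add: powr_powr powr_half_sqrt flip: powr_numeral)
      qed simp
      then show ?thesis using r D(2) by (simp add: powr_mult)
    qed
    finally show "L6_norm (quadratic_exp_sum M a) \<le> D powr (1 / 6) * sqrt ?r" .
  qed
qed

text \<open>The frequencies up to \<open>M\<close> lie below \<open>3^J\<close> as soon as \<open>J > ln M\<close>. The factor 3 absorbs
  rounding, as \<open>ln M\<close> is at least \<open>1/2\<close>.\<close>

lemma best_constant_le_log_power:
  assumes M: "2 \<le> M"
  shows "best_constant M \<le> (10 ^ 15 * 3 ^ 11) powr (1 / 6) * ln (real M) powr (11 / 6)"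
proof -
  define l where "l = ln (real M)"
  define J where "J = nat \<lfloor>l\<rfloor> + 1"
  have "ln 2 \<le> l" using M by (simp add: l_def)
  then have l: "1 / 2 \<le> l" using ln2_ge_two_thirds by linarith
  have J: "l < real J" "real J \<le> l + 1"
    using l unfolding J_def by linarith+
  have "real M = exp l" using M by (simp add: l_def)
  also have "\<dots> < exp (real J)" using J by simp
  also have "\<dots> = exp 1 ^ J" by (simp flip: exp_of_nat_mult)
  also have "\<dots> \<le> 3 ^ J" by (intro power_mono exp_le) simp
  finally have "real_of_int (int M) < real_of_int (3 ^ J)" by simp
  then have "int M < 3 ^ J" by (simp only: of_int_less_iff)
  then have "best_constant M \<le> (10 ^ 15 * real J ^ 11) powr (1 / 6)"
    using M by (intro best_constant_le_of_energy_bound[of M J] energy_bound_log_power) (auto simp: J_def)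
  also have "\<dots> \<le> (10 ^ 15 * (3 * l) ^ 11) powr (1 / 6)"
    using J l by (intro powr_mono2 mult_left_mono power_mono) auto
  also have "10 ^ 15 * (3 * l) ^ 11 = (10 ^ 15 * 3 ^ 11) * l powr 11"
    using l by (simp add: power_mult_distrib flip: powr_numeral)
  also have "\<dots> powr (1 / 6) = (10 ^ 15 * 3 ^ 11) powr (1 / 6) * l powr (11 / 6)"
    by (subst powr_mult) (auto simp: powr_powr)
  finally show ?thesis by (simp only: l_def)
qed

text \<open>The exponent \<open>11/6\<close> is less than \<open>2 + \<epsilon>\<close>. The constant compensates for the fact that \<open>ln M\<close> may be less than 1,
  when the larger exponent gives the smaller power.\<close>

theorem theorem1p1:
  shows "\<forall>\<epsilon>::real. \<epsilon> > 0 \<longrightarrow>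
    (\<exists>C::real. C > 0 \<and>
      (\<forall>M::nat. M \<ge> 2 \<longrightarrow> best_constant M \<le> C * (ln (real M)) powr (2 + \<epsilon>)))"
proof (intro allI impI)
  fix \<epsilon> :: real assume \<epsilon>: "\<epsilon> > 0"
  define c where "c = (10 ^ 15 * 3 ^ 11 :: real) powr (1 / 6)"
  define C where "C = c * (1 / 2) powr - (1 / 6 + \<epsilon>)"
  have c: "0 < c" by (simp add: c_def)
  show "\<exists>C>0. \<forall>M::nat. M \<ge> 2 \<longrightarrow> best_constant M \<le> C * ln (real M) powr (2 + \<epsilon>)"
  proof (intro exI conjI allI impI)
    show "0 < C" using c by (simp add: C_def)
    fix M :: nat assume M: "2 \<le> M"
    have "ln 2 \<le> ln (real M)" using M by simp
    then have l: "1 / 2 \<le> ln (real M)" using ln2_ge_two_thirds by linarith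
    have "best_constant M \<le> c * ln (real M) powr (11 / 6)"
      unfolding c_def by (rule best_constant_le_log_power[OF M])
    also have "ln (real M) powr (11 / 6) = ln (real M) powr - (1 / 6 + \<epsilon>) * ln (real M) powr (2 + \<epsilon>)"
      by (simp flip: powr_add)
    also have "\<dots> \<le> (1 / 2) powr - (1 / 6 + \<epsilon>) * ln (real M) powr (2 + \<epsilon>)"
      using l \<epsilon> by (intro mult_right_mono powr_mono2') auto
    finally show "best_constant M \<le> C * ln (real M) powr (2 + \<epsilon>)"
      using c by (simp add: C_def mult_left_mono mult.assoc)
  qed
qed

end
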